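(* There is an absolute constant $C>0$ such that, for every entire function $F:\mathbb{C}\to\mathbb{C}$ with $F^2\in\mathcal{F}^2(\mathbb{C})$, \[ \inf_{\lambda\in\mathbb{C},\,|\lambda|=1}\|F^2-\lambda\|_{\mathcal{F}^2(\mathbb{C})} \leq C\,\||F|^2-1\|_{\mathcal{F}^2(\mathbb{C})}. \]
   Context: Let $m$ denote Lebesgue measure on $\mathbb{C}\cong\mathbb{R}^2$ and let $\gamma$ be the Gaussian probability measure on $\mathbb{C}$ given by $\mathrm{d}\gamma(z)=\frac{1}{\pi}e^{-|z|^2}\,\mathrm{d}m(z)$. For a measurable function $H:\mathbb{C}\to\mathbb{C}$ (not necessarily holomorphic) write $\|H\|_{\mathcal{F}^2(\mathbb{C})}^2:=\int_{\mathbb{C}}|H(z)|^2\,\mathrm{d}\gamma(z)$. The Fock space $\mathcal{F}^2(\mathbb{C})$ is the space of entire functions $H$ with $\|H\|_{\mathcal{F}^2(\mathbb{C})}<\infty$. Here $F^2$ is the pointwise square $z\mapsto F(z)^2$. "Absolute constant" means that $C$ does not depend on $F$. *)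

theory Defs
  imports "HOL-Analysis.Analysis"
begin

definition gaussian_measure :: "complex measure" where
  "gaussian_measure = density lborel (\<lambda>z. ennreal (exp (- (cmod z)\<^sup>2) / pi))"

definition fock_norm_sq :: "(complex \<Rightarrow> complex) \<Rightarrow> ennreal" where
  "fock_norm_sq H = (\<integral>\<^sup>+ z. ennreal ((cmod (H z))\<^sup>2) \<partial>gaussian_measure)"

(* The norm takes values in [0, \<infinity>] and is meant for arbitrary measurable functions. The case
   distinction is the square root on ennreal, needed because enn2real maps \<infinity> to 0. *)
definition fock_norm :: "(complex \<Rightarrow> complex) \<Rightarrow> ennreal" where
  "fock_norm H =
    (if fock_norm_sq H = \<infinity> then \<infinity> else ennreal (sqrt (enn2real (fock_norm_sq H))))"

definition fock_space :: "(complex \<Rightarrow> complex) set" where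
  "fock_space = {H. H holomorphic_on UNIV \<and> fock_norm H < \<infinity>}"

end

theory Submission
  imports Defs "HOL-Probability.Distributions" "HOL-Complex_Analysis.Cauchy_Integral_Formula"
begin

text \<open>
Let \<open>u = \<bar>F\<bar>\<^sup>2\<close> and \<open>f = F - F 0\<close>, and let \<open>\<parallel>\<sqdot>\<parallel>\<close> be the norm of \<open>L\<^sup>2(\<gamma>)\<close>. Expanding
\<open>\<bar>F\<^sup>2 - \<lambda>\<bar>\<^sup>2\<close> and using the mean value property on circles around the origin, one finds, for the unimodular
\<open>\<lambda>\<close> in the direction of \<open>(F 0)\<^sup>2\<close>,
\<open>\<parallel>F\<^sup>2 - \<lambda>\<parallel>\<^sup>2 = \<parallel>u - 1\<parallel>\<^sup>2 + 2 \<parallel>f\<parallel>\<^sup>2\<close> (lemma \<open>fock_distance_identity\<close>). It remains to bound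
\<open>\<parallel>f\<parallel>\<close> by \<open>\<parallel>u - 1\<parallel>\<close>.

Bounding \<open>\<parallel>f\<parallel>\<close> by \<open>\<parallel>F'\<parallel>\<close> would lose too much: \<open>\<parallel>F'\<parallel>\<close> is not controlled by \<open>\<parallel>u - 1\<parallel>\<close>, as
\<open>F = 1 + \<epsilon> z\<^sup>n\<close> with tiny \<open>\<epsilon>\<close> and large \<open>n\<close> shows. But the monomials are orthogonal with
\<open>\<integral>\<bar>z\<bar>\<^sup>2\<^sup>n d\<gamma> = n!\<close>, and comparing coefficients yields the sharper Hardy inequality
\<open>\<parallel>f\<parallel>\<^sup>2 \<le> 2 \<integral>\<bar>F'\<bar>\<^sup>2/(1 + \<bar>z\<bar>\<^sup>2) d\<gamma>\<close> (lemma \<open>fock_hardy_inequality\<close>). The damping factor is the square of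
\<open>\<rho>(z) = (1 + \<bar>z\<bar>\<^sup>2)\<^sup>-\<^sup>1\<^sup>/\<^sup>2\<close>, the scale on which the Gaussian density is constant up to a fixed factor.
Hence it suffices to bound \<open>\<rho>\<^sup>2\<bar>F'(z)\<bar>\<^sup>2\<close> by the average of \<open>(u - 1)\<^sup>2\<close> over the disc of radius
\<open>2\<rho>\<close> around \<open>z\<close>; integrating in \<open>z\<close> and exchanging the integrals then gives lemma
\<open>weighted_deriv_bound\<close>.

The local bound is the heart of the matter (lemma \<open>first_coeff_bound\<close>). Let \<open>c\<^sub>n\<close> be the Taylor coefficients
of \<open>F\<close> at \<open>z\<close>, scaled to a circle around \<open>z\<close>. The mean of \<open>u\<close> over that circle is
\<open>\<bar>c\<^sub>0\<bar>\<^sup>2 + M\<close> with \<open>M = \<Sum>\<^sub>n\<^sub>\<ge>\<^sub>1 \<bar>c\<^sub>n\<bar>\<^sup>2\<close>, and over the circle of twice the radius it exceeds this by at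
least \<open>3M\<close>. So \<open>M\<close>, and with it \<open>\<bar>1 - \<bar>c\<^sub>0\<bar>\<^sup>2\<bar>\<close>, is bounded by the \<open>L\<^sup>1\<close> means of \<open>u - 1\<close> over the
two circles. The first Fourier coefficient of \<open>u - 1\<close> is the conjugate of \<open>c\<^sub>0\<close> times
\<open>c\<^sub>1\<close>, up to an error of at most \<open>M\<close>, so \<open>\<bar>c\<^sub>0 c\<^sub>1\<bar>\<close> has the same bound. Finally
\<open>\<bar>c\<^sub>1\<bar>\<^sup>2 = \<bar>c\<^sub>0 c\<^sub>1\<bar>\<^sup>2 + (1 - \<bar>c\<^sub>0\<bar>\<^sup>2) \<bar>c\<^sub>1\<bar>\<^sup>2\<close> with \<open>\<bar>c\<^sub>1\<bar>\<^sup>2 \<le> M\<close>: every term is a product of two small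
factors.
\<close>

section \<open>Lebesgue measure on the plane\<close>

lemma sets_ball_borel [measurable, simp]: "ball x r \<in> sets borel" for x :: "'a::metric_space"
  by (rule borel_open) simp

lemma sets_cball_borel [measurable, simp]: "cball x r \<in> sets borel" for x :: "'a::heine_borel"
  by (rule borel_closed) simp

lemma nn_integral_lborel_translate:
  fixes c :: "'a::euclidean_space"
  assumes [measurable]: "f \<in> borel_measurable borel"
  shows "(\<integral>\<^sup>+ x. f (x + c) \<partial>lborel) = (\<integral>\<^sup>+ x. f x \<partial>lborel)"
proof -
  have "(\<integral>\<^sup>+ x. f x \<partial>lborel) = (\<integral>\<^sup>+ x. f x \<partial>distr lborel borel ((+) c))"
    by (simp add: lborel_distr_plus)
  also have "\<dots> = (\<integral>\<^sup>+ x. f (x + c) \<partial>lborel)"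
    by (subst nn_integral_distr) (auto simp: add.commute)
  finally show ?thesis ..
qed

text \<open>
Uniqueness of Haar measure, proved by Fubini: shifting variables in the double integral of \<open>B(x) 1\<^sub>A(y)\<close> against
\<open>lborel \<otimes> N\<close>, with \<open>B\<close> the indicator of the unit ball, moves the set \<open>A\<close> from
\<open>N\<close> to \<open>lborel\<close>. The unit ball is symmetric, so the reflection that occurs on the way is harmless.
\<close>

lemma translation_invariant_eq_lborel:
  fixes N :: "'a::euclidean_space measure"
  assumes sets_N [measurable_cong]: "sets N = sets borel"
    and inv: "\<And>g c. g \<in> borel_measurable borel \<Longrightarrow> (\<integral>\<^sup>+ x. g (x + c) \<partial>N) = (\<integral>\<^sup>+ x. g x \<partial>N)"
    and ball: "emeasure N (ball 0 1) = emeasure lborel (ball (0::'a) 1)"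
    and fin: "sigma_finite_measure N"
  shows "N = lborel"
proof (rule measure_eqI)
  show "sets N = sets lborel" by (simp add: sets_N)
  fix A assume "A \<in> sets N"
  hence A [measurable]: "A \<in> sets borel" by (simp add: sets_N)
  interpret N: sigma_finite_measure N by fact
  interpret P: pair_sigma_finite lborel N ..
  define B :: "'a \<Rightarrow> ennreal" where "B = indicator (ball 0 1)"
  define I :: "'a \<Rightarrow> ennreal" where "I = indicator A"
  have [measurable]: "B \<in> borel_measurable borel" "I \<in> borel_measurable borel"
    unfolding B_def I_def by (rule borel_measurable_indicator, simp)+
  let ?b = "emeasure lborel (ball (0::'a) 1)"
  have b: "?b \<noteq> 0" "?b \<noteq> \<infinity>"
    using unit_ball_vol_pos[of "real DIM('a)"] by (auto simp: emeasure_ball simp del: unit_ball_vol_pos)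
  have "?b * emeasure N A = (\<integral>\<^sup>+ x. B x * (\<integral>\<^sup>+ y. I y \<partial>N) \<partial>lborel)"
    by (subst nn_integral_multc) (auto simp: sets_N B_def I_def)
  also have "\<dots> = (\<integral>\<^sup>+ x. B x * (\<integral>\<^sup>+ y. I (y + x) \<partial>N) \<partial>lborel)"
    by (subst inv) auto
  also have "\<dots> = (\<integral>\<^sup>+ x. (\<integral>\<^sup>+ y. B x * I (y + x) \<partial>N) \<partial>lborel)"
    by (intro nn_integral_cong nn_integral_cmult[symmetric]) auto
  also have "\<dots> = (\<integral>\<^sup>+ y. (\<integral>\<^sup>+ x. B x * I (y + x) \<partial>lborel) \<partial>N)"
    by (rule P.Fubini'[symmetric]) measurable
  also have "\<dots> = (\<integral>\<^sup>+ y. (\<integral>\<^sup>+ x. B (x - y) * I x \<partial>lborel) \<partial>N)"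
  proof (rule nn_integral_cong)
    fix y
    show "(\<integral>\<^sup>+ x. B x * I (y + x) \<partial>lborel) = (\<integral>\<^sup>+ x. B (x - y) * I x \<partial>lborel)"
      using nn_integral_lborel_translate[of "\<lambda>x. B (x - y) * I x" y] 
      by (simp add: add.commute)
  qed
  also have "\<dots> = (\<integral>\<^sup>+ x. (\<integral>\<^sup>+ y. B (x - y) * I x \<partial>N) \<partial>lborel)"
    by (rule P.Fubini') measurable
  also have "\<dots> = (\<integral>\<^sup>+ x. (\<integral>\<^sup>+ y. B (x - y) \<partial>N) * I x \<partial>lborel)"
    by (intro nn_integral_cong nn_integral_multc) auto
  also have "\<dots> = (\<integral>\<^sup>+ x. ?b * I x \<partial>lborel)"
  proof (rule nn_integral_cong)
    fix x :: 'a
    have "(\<integral>\<^sup>+ y. B (x - y) \<partial>N) = (\<integral>\<^sup>+ y. B (y + (- x)) \<partial>N)"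
      by (intro nn_integral_cong) (auto simp: B_def indicator_def norm_minus_commute)
    also have "\<dots> = ?b" by (subst inv) (auto simp: sets_N ball B_def)
    finally show "(\<integral>\<^sup>+ y. B (x - y) \<partial>N) * I x = ?b * I x" by simp
  qed
  also have "\<dots> = ?b * emeasure lborel A" by (simp add: nn_integral_cmult I_def)
  finally show "emeasure N A = emeasure lborel A"
    using b by (simp add: ennreal_mult_cancel_left)
qed

text \<open>
The image of Lebesgue measure under a rotation is again translation invariant and gives the unit disc the same mass.
\<close>

lemma nn_integral_lborel_rotate:
  fixes c :: complex
  assumes [measurable]: "f \<in> borel_measurable borel" and c: "cmod c = 1"
  shows "(\<integral>\<^sup>+ z. f (c * z) \<partial>lborel) = (\<integral>\<^sup>+ z. f z \<partial>lborel)"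
proof -
  let ?N = "distr lborel borel ((*) c)"
  have c0: "c \<noteq> 0" using c by auto
  have "?N = lborel"
  proof (rule translation_invariant_eq_lborel)
    fix g :: "complex \<Rightarrow> ennreal" and d assume [measurable]: "g \<in> borel_measurable borel"
    have "(\<integral>\<^sup>+ x. g (x + d) \<partial>?N) = (\<integral>\<^sup>+ x. g (c * (x + d / c)) \<partial>lborel)"
      using c0 by (subst nn_integral_distr) (auto simp: algebra_simps)
    also have "\<dots> = (\<integral>\<^sup>+ x. g (c * x) \<partial>lborel)"
      by (rule nn_integral_lborel_translate) measurable
    also have "\<dots> = (\<integral>\<^sup>+ x. g x \<partial>?N)" by (subst nn_integral_distr) auto
    finally show "(\<integral>\<^sup>+ x. g (x + d) \<partial>?N) = (\<integral>\<^sup>+ x. g x \<partial>?N)" .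
  next
    have "(*) c -` ball 0 1 = ball 0 1" using c by (auto simp: norm_mult)
    thus "emeasure ?N (ball 0 1) = emeasure lborel (ball (0::complex) 1)"
      by (subst emeasure_distr) auto
  next
    have "(*) c -` ball 0 r = ball 0 r" for r using c by (auto simp: norm_mult)
    hence em: "emeasure ?N (ball 0 r) = emeasure lborel (ball (0::complex) r)" for r
      by (subst emeasure_distr) auto
    show "sigma_finite_measure ?N"
    proof
      show "\<exists>A. countable A \<and> A \<subseteq> sets ?N \<and> \<Union>A = space ?N \<and> (\<forall>a\<in>A. emeasure ?N a \<noteq> \<infinity>)"
        using reals_Archimedean2 by (intro exI[of _ "range (\<lambda>n. ball 0 (real n))"]) 
          (auto simp: em emeasure_ball)
    qed
  qed auto
  hence "(\<integral>\<^sup>+ z. f z \<partial>lborel) = (\<integral>\<^sup>+ z. f z \<partial>?N)" by simp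
  also have "\<dots> = (\<integral>\<^sup>+ z. f (c * z) \<partial>lborel)" by (subst nn_integral_distr) auto
  finally show ?thesis ..
qed

lemma nn_integral_lborel_affine:
  fixes z :: complex and s :: real
  assumes [measurable]: "g \<in> borel_measurable borel" and s: "s > 0"
  shows "(\<integral>\<^sup>+ w. g w \<partial>lborel) = (\<integral>\<^sup>+ \<zeta>. ennreal (s\<^sup>2) * g (z + s *\<^sub>R \<zeta>) \<partial>lborel)"
proof -
  have "lborel = density (distr lborel borel (\<lambda>x. z + s *\<^sub>R x)) (\<lambda>_. ennreal (s\<^sup>2))"
    using lborel_affine[of s z] s by simp
  hence "(\<integral>\<^sup>+ w. g w \<partial>lborel)
      = (\<integral>\<^sup>+ w. g w \<partial>density (distr lborel borel (\<lambda>x. z + s *\<^sub>R x)) (\<lambda>_. ennreal (s\<^sup>2)))"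
    by simp
  also have "\<dots> = (\<integral>\<^sup>+ w. ennreal (s\<^sup>2) * g w \<partial>distr lborel borel (\<lambda>x. z + s *\<^sub>R x))"
    by (rule nn_integral_density) auto
  also have "\<dots> = (\<integral>\<^sup>+ \<zeta>. ennreal (s\<^sup>2) * g (z + s *\<^sub>R \<zeta>) \<partial>lborel)"
    by (rule nn_integral_distr) auto
  finally show ?thesis .
qed

lemma nn_integral_unit_cball_affine:
  fixes z :: complex and s :: real
  assumes [measurable]: "g \<in> borel_measurable borel" and s: "s > 0"
  shows "(\<integral>\<^sup>+ \<zeta>. indicator (cball 0 1) \<zeta> * g (z + s *\<^sub>R \<zeta>) \<partial>lborel)
    = ennreal (1 / s\<^sup>2) * (\<integral>\<^sup>+ w. indicator (cball z s) w * g w \<partial>lborel)"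
proof -
  have "(\<integral>\<^sup>+ w. indicator (cball z s) w * g w \<partial>lborel)
    = (\<integral>\<^sup>+ \<zeta>. ennreal (s\<^sup>2) * (indicator (cball z s) (z + s *\<^sub>R \<zeta>) * g (z + s *\<^sub>R \<zeta>)) \<partial>lborel)"
    by (rule nn_integral_lborel_affine[OF _ s], intro borel_measurable_times_ennreal borel_measurable_indicator assms) simp
  also have "\<dots> = ennreal (s\<^sup>2) * (\<integral>\<^sup>+ \<zeta>. indicator (cball 0 1) \<zeta> * g (z + s *\<^sub>R \<zeta>) \<partial>lborel)"
    using s by (subst nn_integral_cmult) (auto intro!: nn_integral_cong simp: indicator_def dist_norm)
  finally show ?thesis
    using s by (simp add: mult.assoc[symmetric] ennreal_mult[symmetric])
qed

text \<open>
Polar coordinates for radial functions: a disc of radius \<open>r\<close> has area \<open>\<pi> r\<^sup>2\<close>, so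
\<open>\<bar>z\<bar>\<^sup>2\<close> is distributed like \<open>\<pi>\<close> times Lebesgue measure on the half-line.
\<close>

lemma distr_cmod_square_lborel:
  "distr lborel borel (\<lambda>z::complex. (cmod z)\<^sup>2) = density lborel (\<lambda>s. ennreal pi * indicator {0..} s)"
  (is "?M = ?N")
proof (rule measure_eqI_generator_eq[where E = "range (\<lambda>x::real. {..x})" and \<Omega> = UNIV and A = "\<lambda>n. {..real n}"])
  have M: "emeasure ?M {..x} = (if x \<ge> 0 then ennreal (pi * x) else 0)" for x
  proof -
    have "(\<lambda>z::complex. (cmod z)\<^sup>2) -` {..x} = (if x \<ge> 0 then cball 0 (sqrt x) else {})"
    proof (cases "x \<ge> 0")
      case True
      thus ?thesis by (auto simp: real_le_rsqrt) (metis norm_ge_zero real_sqrt_le_iff real_sqrt_unique real_sqrt_pow2 power_mono)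
    next
      case False
      thus ?thesis by (auto simp: not_le) (smt (verit) zero_le_power2)
    qed
    thus ?thesis
      by (subst emeasure_distr) (auto simp: emeasure_cball unit_ball_vol_2)
  qed
  have N: "emeasure ?N {..x} = (if x \<ge> 0 then ennreal (pi * x) else 0)" for x
  proof -
    have "emeasure ?N {..x} = (\<integral>\<^sup>+ s. ennreal pi * indicator {0..x} s \<partial>lborel)"
      by (subst emeasure_density) (auto intro!: nn_integral_cong simp: indicator_def)
    also have "\<dots> = (if x \<ge> 0 then ennreal (pi * x) else 0)"
      by (subst nn_integral_cmult) (auto simp: ennreal_mult)
    finally show ?thesis .
  qed
  show "\<And>X. X \<in> range (\<lambda>x::real. {..x}) \<Longrightarrow> emeasure ?M X = emeasure ?N X"
    by (auto simp: M N)
  show "emeasure ?M {..real i} \<noteq> \<infinity>" for i by (simp add: M)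
  show "Int_stable (range (\<lambda>x::real. {..x}))" by (auto simp: Int_stable_def)
  show "sets ?M = sigma_sets UNIV (range (\<lambda>x::real. {..x}))" "sets ?N = sigma_sets UNIV (range (\<lambda>x::real. {..x}))"
    by (simp_all add: borel_eq_atMost)
  show "(\<Union>i. {..real i}) = UNIV" using real_arch_simple by auto
qed auto

lemma nn_integral_radial:
  assumes [measurable]: "g \<in> borel_measurable borel"
  shows "(\<integral>\<^sup>+ z. g ((cmod z)\<^sup>2) \<partial>lborel) = ennreal pi * (\<integral>\<^sup>+ s. g s * indicator {0..} s \<partial>lborel)"
proof -
  have "(\<integral>\<^sup>+ z. g ((cmod z)\<^sup>2) \<partial>lborel) = (\<integral>\<^sup>+ s. g s \<partial>distr lborel borel (\<lambda>z::complex. (cmod z)\<^sup>2))"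
    by (subst nn_integral_distr) auto
  also have "\<dots> = (\<integral>\<^sup>+ s. ennreal pi * (g s * indicator {0..} s) \<partial>lborel)"
    unfolding distr_cmod_square_lborel by (subst nn_integral_density) (auto simp: ac_simps)
  finally show ?thesis by (simp add: nn_integral_cmult)
qed

section \<open>Fourier series on the unit circle\<close>

text \<open>
A measure on the whole plane, concentrated on the circle, so that functions of a complex variable can be integrated and rotated without
reference to angles.
\<close>

definition unit_circle :: "complex measure" where
  "unit_circle = distr (uniform_measure lborel {0..2*pi}) borel cis"

lemma cis_measurable [measurable]: "cis \<in> borel_measurable borel"
  by (intro borel_measurable_continuous_onI continuous_intros)

lemma cis_measurable_uniform [measurable]: "cis \<in> uniform_measure lborel A \<rightarrow>\<^sub>M borel"
  by (simp cong:)

lemma sets_unit_circle [measurable_cong, simp]: "sets unit_circle = sets borel"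
  by (simp add: unit_circle_def)

lemma space_unit_circle [simp]: "space unit_circle = UNIV"
  by (simp add: unit_circle_def)

lemma prob_space_unit_circle: "prob_space unit_circle"
  unfolding unit_circle_def
  by (intro prob_space.prob_space_distr prob_space_uniform_measure) auto

interpretation unit_circle: prob_space unit_circle
  by (rule prob_space_unit_circle)

lemma AE_unit_circle: "AE u in unit_circle. cmod u = 1"
  unfolding unit_circle_def by (subst AE_distr_iff) auto

lemma bounded_on_unit_circle:
  fixes g :: "complex \<Rightarrow> 'a::real_normed_vector"
  assumes "continuous_on UNIV g"
  obtains B where "\<And>u. cmod u = 1 \<Longrightarrow> norm (g u) \<le> B"
proof -
  have "compact (g ` sphere 0 1)"
    by (intro compact_continuous_image continuous_on_subset[OF assms]) auto
  hence "bounded (g ` sphere 0 1)" by (rule compact_imp_bounded)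
  then obtain B where "\<forall>x\<in>g ` sphere 0 1. norm x \<le> B"
    unfolding bounded_iff by blast
  hence "norm (g u) \<le> B" if "cmod u = 1" for u using that by auto
  thus ?thesis by (rule that)
qed

lemma integrable_unit_circle:
  fixes g :: "complex \<Rightarrow> 'a::{banach, second_countable_topology}"
  assumes "continuous_on UNIV g"
  shows "integrable unit_circle g"
proof -
  obtain B where B: "\<And>u. cmod u = 1 \<Longrightarrow> norm (g u) \<le> B"
    using bounded_on_unit_circle[OF assms] by blast
  show ?thesis
  proof (rule unit_circle.integrable_const_bound)
    show "AE u in unit_circle. norm (g u) \<le> B"
      using AE_unit_circle by eventually_elim (rule B)
    show "g \<in> borel_measurable unit_circle"
      using borel_measurable_continuous_onI[OF assms] by simp
  qed
qed

lemma integral_unit_circle_cong: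
  fixes f g :: "complex \<Rightarrow> 'a::{banach, second_countable_topology}"
  assumes "continuous_on UNIV f" "continuous_on UNIV g" "\<And>u. cmod u = 1 \<Longrightarrow> f u = g u"
  shows "(\<integral>u. f u \<partial>unit_circle) = (\<integral>u. g u \<partial>unit_circle)"
  using AE_unit_circle assms(3)
  by (intro integral_cong_AE borel_measurable_integrable integrable_unit_circle assms) (auto elim!: eventually_mono)

lemma integral_unit_circle_power:
  assumes "n \<noteq> 0"
  shows "(\<integral>u. u ^ n \<partial>unit_circle) = 0"
proof -
  let ?F = "\<lambda>t. cis (real n * t) / (\<i> * of_nat n)"
  have "(\<integral>t. indicator {0..2*pi} t *\<^sub>R cis (real n * t) \<partial>lborel) = ?F (2 * pi) - ?F 0"
  proof (rule integral_FTC_atLeastAtMost)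
    fix t :: real
    show "(?F has_vector_derivative cis (real n * t)) (at t within {0..2*pi})"
    proof -
      have "((\<lambda>x. exp (\<i> * of_nat n * x) / (\<i> * of_nat n)) has_field_derivative exp (\<i> * of_nat n * of_real t)) (at (of_real t))"
        using assms by (auto intro!: derivative_eq_intros)
      from has_vector_derivative_real_field[OF this, of "{0..2*pi}"] show ?thesis
        by (simp add: cis_conv_exp mult.assoc)
    qed
  qed (auto intro!: continuous_intros)
  also have "\<dots> = 0" using cis_multiple_2pi[of "real n"] by (simp add: mult.commute mult.left_commute)
  finally have "(\<integral>t. indicator {0..2*pi} t *\<^sub>R cis (real n * t) \<partial>lborel) = 0" .
  moreover have "(\<integral>u. u ^ n \<partial>unit_circle) = (\<integral>t. cis (real n * t) \<partial>uniform_measure lborel {0..2*pi})"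
    unfolding unit_circle_def by (subst integral_distr) (auto simp: Complex.DeMoivre)
  moreover have "uniform_measure lborel {0..2*pi} = density lborel (\<lambda>t. ennreal (indicator {0..2*pi} t / (2*pi)))"
    by (simp add: uniform_measure_def divide_ennreal[symmetric] ennreal_indicator)
  moreover have "(\<integral>t. (indicator {0..2*pi} t / (2*pi)) *\<^sub>R cis (real n * t) \<partial>lborel)
      = (\<integral>t. (1 / (2*pi)) *\<^sub>R (indicator {0..2*pi} t *\<^sub>R cis (real n * t)) \<partial>lborel)"
    by simp
  ultimately show ?thesis
    by (simp add: integral_density del: scaleR_scaleR)
qed

lemma integral_unit_circle_power_cnj:
  "(\<integral>u. u ^ n * cnj u ^ k \<partial>unit_circle) = of_bool (n = k)"
proof -
  have red: "u ^ (k + j) * cnj u ^ k = u ^ j" if "cmod u = 1" for u j k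
  proof -
    have "u ^ (k + j) * cnj u ^ k = (u * cnj u) ^ k * u ^ j"
      by (simp add: power_add power_mult_distrib)
    thus ?thesis using that by (simp add: complex_norm_square[symmetric])
  qed
  consider "n = k" | j where "n = k + Suc j" | j where "k = n + Suc j"
    by (metis less_imp_Suc_add linorder_neqE_nat add_Suc_right)
  thus ?thesis
  proof cases
    case 1
    have "(\<integral>u. u ^ n * cnj u ^ k \<partial>unit_circle) = (\<integral>u. 1 \<partial>unit_circle)"
      using red[where j = 0] by (intro integral_unit_circle_cong continuous_intros) (simp add: 1)
    thus ?thesis using 1 unit_circle.prob_space by simp
  next
    case 2
    have "(\<integral>u. u ^ n * cnj u ^ k \<partial>unit_circle) = (\<integral>u. u ^ Suc j \<partial>unit_circle)"
      unfolding 2 by (intro integral_unit_circle_cong continuous_intros red)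
    thus ?thesis using 2 integral_unit_circle_power[of "Suc j"] by simp
  next
    case 3
    have "(\<integral>u. u ^ n * cnj u ^ k \<partial>unit_circle) = (\<integral>u. cnj (u ^ Suc j) \<partial>unit_circle)"
      unfolding 3 using red[of "cnj u" n "Suc j" for u]
      by (intro integral_unit_circle_cong continuous_intros) (simp add: mult.commute del: power_Suc)
    also have "\<dots> = cnj (\<integral>u. u ^ Suc j \<partial>unit_circle)"
      by (rule Bochner_Integration.integral_cnj)
    finally show ?thesis using 3 integral_unit_circle_power[of "Suc j"] by simp
  qed
qed

text \<open>
The setting of all circle computations: a function whose restriction to the unit circle is an absolutely convergent Fourier series with
nonnegative frequencies. Continuity is asked on the whole plane so that measurability and integrability with respect to the circle measure
come for free.
\<close>

locale circle_series =
  fixes c :: "nat \<Rightarrow> complex" and G :: "complex \<Rightarrow> complex"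
  assumes cont: "continuous_on UNIV G"
    and summable_c: "summable (\<lambda>n. cmod (c n))"
    and sums_G: "\<And>u. cmod u = 1 \<Longrightarrow> (\<lambda>n. c n * u ^ n) sums G u"
begin

text \<open>
Term-by-term integration against a bounded function; the coefficient formula, the vanishing of the negative frequencies and Parseval's
identity are instances.
\<close>

lemma sums_integral_mult:
  assumes phi: "continuous_on UNIV \<phi>" and bound: "\<And>u. cmod u = 1 \<Longrightarrow> cmod (\<phi> u) \<le> B"
  shows "(\<lambda>n. c n * (\<integral>u. u ^ n * \<phi> u \<partial>unit_circle)) sums (\<integral>u. G u * \<phi> u \<partial>unit_circle)"
proof -
  have int: "integrable unit_circle (\<lambda>u. c n * u ^ n * \<phi> u)" for n
    by (intro integrable_unit_circle continuous_intros phi)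
  have n1: "cmod (c n * u ^ n * \<phi> u) \<le> cmod (c n) * B" if "cmod u = 1" for u n
    using that bound[OF that] by (simp add: norm_mult norm_power mult_left_mono)
  have "(\<lambda>n. \<integral>u. c n * u ^ n * \<phi> u \<partial>unit_circle) sums (\<integral>u. (\<Sum>n. c n * u ^ n * \<phi> u) \<partial>unit_circle)"
  proof (rule sums_integral[OF int])
    show "AE u in unit_circle. summable (\<lambda>n. norm (c n * u ^ n * \<phi> u))"
      using AE_unit_circle
    proof eventually_elim
      case (elim u)
      show ?case
        by (rule summable_comparison_test'[OF summable_mult2[OF summable_c, of B]]) (use n1[OF elim] in auto)
    qed
    show "summable (\<lambda>n. \<integral>u. norm (c n * u ^ n * \<phi> u) \<partial>unit_circle)"
    proof (rule summable_comparison_test'[OF summable_mult2[OF summable_c, of B]])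
      fix n :: nat
      have "(\<integral>u. norm (c n * u ^ n * \<phi> u) \<partial>unit_circle) \<le> (\<integral>u. cmod (c n) * B \<partial>unit_circle)"
        using AE_unit_circle
        by (intro integral_mono_AE integrable_norm int) (auto elim!: eventually_mono n1)
      thus "norm (\<integral>u. norm (c n * u ^ n * \<phi> u) \<partial>unit_circle) \<le> cmod (c n) * B"
        using unit_circle.prob_space by simp
    qed
  qed
  also have "(\<integral>u. (\<Sum>n. c n * u ^ n * \<phi> u) \<partial>unit_circle) = (\<integral>u. G u * \<phi> u \<partial>unit_circle)"
  proof (rule integral_cong_AE)
    show "AE u in unit_circle. (\<Sum>n. c n * u ^ n * \<phi> u) = G u * \<phi> u"
      using AE_unit_circle by eventually_elim (metis sums_unique sums_mult2 sums_G)
    show "(\<lambda>u. G u * \<phi> u) \<in> borel_measurable unit_circle"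
      by (intro borel_measurable_integrable integrable_unit_circle continuous_intros phi cont)
    show "(\<lambda>u. \<Sum>n. c n * u ^ n * \<phi> u) \<in> borel_measurable unit_circle"
      using int by (intro borel_measurable_suminf) auto
  qed
  finally show ?thesis by (simp add: mult.assoc)
qed

lemma integral_coeff: "(\<integral>u. G u * cnj u ^ k \<partial>unit_circle) = c k"
proof -
  have "(\<lambda>n. c n * of_bool (n = k)) sums (\<integral>u. G u * cnj u ^ k \<partial>unit_circle)"
  proof -
    have "continuous_on UNIV (\<lambda>u. cnj u ^ k)" by (intro continuous_intros)
    from sums_integral_mult[OF this, of 1] show ?thesis
      by (simp add: integral_unit_circle_power_cnj norm_power)
  qed
  moreover have "(\<lambda>n. c n * of_bool (n = k)) sums c k"
    using sums_single[of k c] by (simp add: of_bool_def mult_if_delta if_distrib cong: if_cong)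
  ultimately show ?thesis by (rule sums_unique2)
qed

lemma integral_mult_pos: "(\<integral>u. G u * u ^ Suc k \<partial>unit_circle) = 0"
proof -
  have "(\<integral>u. u ^ n * u ^ Suc k \<partial>unit_circle) = 0" for n
    unfolding power_add[symmetric] by (rule integral_unit_circle_power) simp
  moreover have "(\<lambda>n. c n * (\<integral>u. u ^ n * u ^ Suc k \<partial>unit_circle)) sums (\<integral>u. G u * u ^ Suc k \<partial>unit_circle)"
    by (rule sums_integral_mult[where B = 1]) (auto intro!: continuous_intros simp: norm_power norm_mult)
  ultimately have "(\<lambda>n. 0) sums (\<integral>u. G u * u ^ Suc k \<partial>unit_circle)"
    by (simp only: mult_zero_right)
  thus ?thesis using sums_unique[of "\<lambda>n. 0::complex"] by simp
qed

lemma parseval: "(\<lambda>n. (cmod (c n))\<^sup>2) sums (\<integral>u. (cmod (G u))\<^sup>2 \<partial>unit_circle)"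
proof -
  have cont': "continuous_on UNIV (\<lambda>u. cnj (G u))" by (intro continuous_intros cont)
  obtain B where B: "\<And>u. cmod u = 1 \<Longrightarrow> cmod (cnj (G u)) \<le> B"
    using bounded_on_unit_circle[OF cont'] by blast
  have eq: "(\<integral>u. u ^ n * cnj (G u) \<partial>unit_circle) = cnj (c n)" for n
  proof -
    have "cnj (\<integral>u. G u * cnj u ^ n \<partial>unit_circle) = (\<integral>u. cnj (G u * cnj u ^ n) \<partial>unit_circle)"
      by (rule Bochner_Integration.integral_cnj[symmetric])
    thus ?thesis by (simp add: integral_coeff mult.commute)
  qed
  have "(\<lambda>n. c n * (\<integral>u. u ^ n * cnj (G u) \<partial>unit_circle)) sums (\<integral>u. G u * cnj (G u) \<partial>unit_circle)"
    by (rule sums_integral_mult[OF cont' B])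
  hence "(\<lambda>n. complex_of_real ((cmod (c n))\<^sup>2)) sums (\<integral>u. complex_of_real ((cmod (G u))\<^sup>2) \<partial>unit_circle)"
    by (simp only: eq complex_norm_square)
  hence "(\<lambda>n. complex_of_real ((cmod (c n))\<^sup>2)) sums complex_of_real (\<integral>u. (cmod (G u))\<^sup>2 \<partial>unit_circle)"
    by (simp only: integral_complex_of_real)
  thus ?thesis by (simp only: sums_of_real_iff)
qed

end

section \<open>Circle means of an entire function\<close>

text \<open>
The variance of \<open>\<bar>h\<bar>\<close> is nonnegative.
\<close>

lemma circle_mean_square_le:
  fixes h :: "complex \<Rightarrow> real"
  assumes "continuous_on UNIV h"
  shows "(\<integral>u. \<bar>h u\<bar> \<partial>unit_circle)\<^sup>2 \<le> (\<integral>u. (h u)\<^sup>2 \<partial>unit_circle)"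
proof -
  have "integrable unit_circle (\<lambda>u. \<bar>h u\<bar>)" "integrable unit_circle (\<lambda>u. \<bar>h u\<bar>\<^sup>2)"
    by (intro integrable_unit_circle continuous_intros assms)+
  from unit_circle.variance_eq[OF this] unit_circle.variance_positive[of "\<lambda>u. \<bar>h u\<bar>"]
  show ?thesis by simp
qed

lemma integral_of_real_mult_cnj_le:
  assumes h: "continuous_on UNIV h"
  shows "cmod (\<integral>u. of_real (h u) * cnj u \<partial>unit_circle) \<le> (\<integral>u. \<bar>h u\<bar> \<partial>unit_circle)"
proof -
  have [measurable]: "h \<in> borel_measurable borel"
    by (rule borel_measurable_continuous_onI[OF h])
  have "cmod (\<integral>u. of_real (h u) * cnj u \<partial>unit_circle) \<le> (\<integral>u. cmod (of_real (h u) * cnj u) \<partial>unit_circle)"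
    by (rule integral_norm_bound)
  also have "\<dots> = (\<integral>u. \<bar>h u\<bar> \<partial>unit_circle)"
    using AE_unit_circle by (intro integral_cong_AE) (auto simp: norm_mult)
  finally show ?thesis .
qed

context circle_series
begin

lemma integrable_G [simp]:
  "integrable unit_circle G" "integrable unit_circle (\<lambda>u. (cmod (G u))\<^sup>2)"
  by (intro integrable_unit_circle continuous_intros cont)+

lemma mean_value: "(\<integral>u. G u \<partial>unit_circle) = c 0"
  using integral_coeff[of 0] by simp

lemma mean_square_deviation:
  "(\<integral>u. (cmod (G u - c 0))\<^sup>2 \<partial>unit_circle) = (\<integral>u. (cmod (G u))\<^sup>2 \<partial>unit_circle) - (cmod (c 0))\<^sup>2"
proof -
  have eq: "(cmod (G u - c 0))\<^sup>2 = (cmod (G u))\<^sup>2 - 2 * Re (cnj (c 0) * G u) + (cmod (c 0))\<^sup>2" for u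
    unfolding cmod_power2 by (simp add: power2_eq_square algebra_simps)
  have "(\<integral>u. Re (cnj (c 0) * G u) \<partial>unit_circle) = Re (\<integral>u. cnj (c 0) * G u \<partial>unit_circle)"
    by (rule integral_Re) (intro integrable_mult_right integrable_G)
  also have "\<dots> = (cmod (c 0))\<^sup>2"
    unfolding cmod_power2 by (simp add: mean_value power2_eq_square)
  finally have "(\<integral>u. Re (cnj (c 0) * G u) \<partial>unit_circle) = (cmod (c 0))\<^sup>2" .
  moreover have "integrable unit_circle (\<lambda>u. Re (cnj (c 0) * G u))"
    by (intro integrable_unit_circle continuous_intros cont)
  ultimately show ?thesis
    unfolding eq using unit_circle.prob_space by simp
qed

lemma parseval_deviation:
  "(\<lambda>n. (cmod (c (Suc n)))\<^sup>2) sums (\<integral>u. (cmod (G u - c 0))\<^sup>2 \<partial>unit_circle)"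
  unfolding mean_square_deviation using parseval sums_Suc_iff[of "\<lambda>n. (cmod (c n))\<^sup>2"] by simp

text \<open>
With \<open>f = G - c\<^sub>0\<close>, the function \<open>\<bar>G\<bar>\<^sup>2\<close> is the sum of \<open>\<bar>f\<bar>\<^sup>2\<close>,
a constant, the conjugate of \<open>c\<^sub>0\<close> times \<open>G\<close>, and \<open>c\<^sub>0\<close> times the conjugate of
\<open>G\<close>. The last of these has no positive frequencies, so the first Fourier coefficient of
\<open>\<bar>G\<bar>\<^sup>2 - 1\<close> is \<open>c\<^sub>1\<close> times the conjugate of \<open>c\<^sub>0\<close> plus that of
\<open>\<bar>f\<bar>\<^sup>2\<close>.
\<close>

lemma first_coeff_times_mean:
  "cmod (c 0) * cmod (c 1) \<le> (\<integral>u. \<bar>(cmod (G u))\<^sup>2 - 1\<bar> \<partial>unit_circle)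
     + (\<integral>u. (cmod (G u - c 0))\<^sup>2 \<partial>unit_circle)"
proof -
  note ci = integrable_unit_circle continuous_intros cont
  let ?h = "\<lambda>u. (cmod (G u))\<^sup>2 - 1" and ?f = "\<lambda>u. G u - c 0"
  have eq: "of_real (?h u) * cnj u - of_real ((cmod (?f u))\<^sup>2) * cnj u
     = cnj (c 0) * (G u * cnj u ^ 1) + c 0 * cnj (G u * u ^ Suc 0) - (c 0 * cnj (c 0) + 1) * cnj u" for u
    unfolding of_real_diff complex_norm_square by (simp add: algebra_simps)
  have "(\<integral>u. of_real (?h u) * cnj u \<partial>unit_circle) - (\<integral>u. of_real ((cmod (?f u))\<^sup>2) * cnj u \<partial>unit_circle)
    = (\<integral>u. of_real (?h u) * cnj u - of_real ((cmod (?f u))\<^sup>2) * cnj u \<partial>unit_circle)"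
    by (rule Bochner_Integration.integral_diff[symmetric]) (intro ci)+
  also have "\<dots> = (\<integral>u. cnj (c 0) * (G u * cnj u ^ 1) \<partial>unit_circle) 
      + (\<integral>u. c 0 * cnj (G u * u ^ Suc 0) \<partial>unit_circle) 
      - (\<integral>u. (c 0 * cnj (c 0) + 1) * cnj u \<partial>unit_circle)"
    unfolding eq
    by (subst Bochner_Integration.integral_diff, (intro ci)+, subst Bochner_Integration.integral_add, (intro ci)+, rule refl)
  also have "(\<integral>u. cnj (c 0) * (G u * cnj u ^ 1) \<partial>unit_circle) = cnj (c 0) * c 1"
    by (subst integral_mult_right_zero) (simp only: integral_coeff)
  also have "(\<integral>u. c 0 * cnj (G u * u ^ Suc 0) \<partial>unit_circle) = 0"
    by (subst integral_mult_right_zero, subst Bochner_Integration.integral_cnj, subst integral_mult_pos) simp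
  also have "(\<integral>u. (c 0 * cnj (c 0) + 1) * cnj u \<partial>unit_circle) = 0"
    using integral_unit_circle_power[of 1] by (subst integral_mult_right_zero, subst Bochner_Integration.integral_cnj) simp
  finally have "cnj (c 0) * c 1 = (\<integral>u. of_real (?h u) * cnj u \<partial>unit_circle)
      - (\<integral>u. of_real ((cmod (?f u))\<^sup>2) * cnj u \<partial>unit_circle)" by simp
  hence "cmod (cnj (c 0) * c 1) \<le> cmod (\<integral>u. of_real (?h u) * cnj u \<partial>unit_circle)
      + cmod (\<integral>u. of_real ((cmod (?f u))\<^sup>2) * cnj u \<partial>unit_circle)"
    by (simp only: norm_triangle_ineq4)
  also have "cmod (\<integral>u. of_real (?h u) * cnj u \<partial>unit_circle) \<le> (\<integral>u. \<bar>?h u\<bar> \<partial>unit_circle)"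
    by (intro integral_of_real_mult_cnj_le ci)
  also have "cmod (\<integral>u. of_real ((cmod (?f u))\<^sup>2) * cnj u \<partial>unit_circle) \<le> (\<integral>u. (cmod (?f u))\<^sup>2 \<partial>unit_circle)"
    using integral_of_real_mult_cnj_le[of "\<lambda>u. (cmod (?f u))\<^sup>2"] by (simp add: ci)
  finally show ?thesis by (simp add: norm_mult)
qed

end

text \<open>
A second circle is indispensable: a function like \<open>z\<^sup>n\<close> has modulus one on the unit circle without being constant.
Doubling the radius multiplies \<open>\<bar>c\<^sub>n\<bar>\<^sup>2\<close> by at least four for every \<open>n \<ge> 1\<close>, and this
growth makes the nonconstant part visible in \<open>\<bar>G\<bar>\<^sup>2\<close>.
\<close>

lemma first_coeff_bound:
  assumes "circle_series c G" and "circle_series (\<lambda>n. 2 ^ n * c n) G2"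
  shows "(cmod (c 1))\<^sup>2 \<le> 4 * ((\<integral>u. ((cmod (G u))\<^sup>2 - 1)\<^sup>2 \<partial>unit_circle)
    + (\<integral>u. ((cmod (G2 u))\<^sup>2 - 1)\<^sup>2 \<partial>unit_circle))"
proof -
  interpret G: circle_series c G by fact
  interpret G2: circle_series "\<lambda>n. 2 ^ n * c n" G2 by fact
  define A1 A2 where "A1 = (\<integral>u. \<bar>(cmod (G u))\<^sup>2 - 1\<bar> \<partial>unit_circle)" 
    and "A2 = (\<integral>u. \<bar>(cmod (G2 u))\<^sup>2 - 1\<bar> \<partial>unit_circle)"
  define M M2 where "M = (\<integral>u. (cmod (G u - c 0))\<^sup>2 \<partial>unit_circle)"
    and "M2 = (\<integral>u. (cmod (G2 u - 2 ^ 0 * c 0))\<^sup>2 \<partial>unit_circle)"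
  define x y where "x = cmod (c 0)" and "y = cmod (c 1)"
  have nonneg: "0 \<le> x" "0 \<le> y" "0 \<le> A1" "0 \<le> A2" "0 \<le> M"
    unfolding x_def y_def A1_def A2_def M_def by (auto intro: integral_nonneg_AE)
  have I: "\<bar>(\<integral>u. (cmod (G u))\<^sup>2 \<partial>unit_circle) - 1\<bar> \<le> A1"
  proof -
    have "(\<integral>u. (cmod (G u))\<^sup>2 \<partial>unit_circle) - 1 = (\<integral>u. (cmod (G u))\<^sup>2 - 1 \<partial>unit_circle)"
      using unit_circle.prob_space by simp
    also have "\<bar>\<dots>\<bar> \<le> A1" unfolding A1_def by (rule integral_abs_bound)
    finally show ?thesis .
  qed
  have I2: "\<bar>(\<integral>u. (cmod (G2 u))\<^sup>2 \<partial>unit_circle) - 1\<bar> \<le> A2"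
  proof -
    have "(\<integral>u. (cmod (G2 u))\<^sup>2 \<partial>unit_circle) - 1 = (\<integral>u. (cmod (G2 u))\<^sup>2 - 1 \<partial>unit_circle)"
      using unit_circle.prob_space by simp
    also have "\<bar>\<dots>\<bar> \<le> A2" unfolding A2_def by (rule integral_abs_bound)
    finally show ?thesis .
  qed
  have eqM: "(\<integral>u. (cmod (G u))\<^sup>2 \<partial>unit_circle) = x\<^sup>2 + M"
    unfolding M_def G.mean_square_deviation x_def by simp
  have eqM2: "(\<integral>u. (cmod (G2 u))\<^sup>2 \<partial>unit_circle) = x\<^sup>2 + M2"
    unfolding M2_def G2.mean_square_deviation x_def by simp
  note S = G.parseval_deviation[folded M_def] and S2 = G2.parseval_deviation[folded M2_def]
  have "4 * M \<le> M2"
  proof (rule sums_le[OF _ sums_mult[OF S, of 4] S2])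
    fix n :: nat
    have "(4::real) * 1 \<le> (2 ^ Suc n)\<^sup>2" by (simp add: power_mult_distrib)
    thus "4 * (cmod (c (Suc n)))\<^sup>2 \<le> (cmod (2 ^ Suc n * c (Suc n)))\<^sup>2"
      unfolding norm_mult power_mult_distrib by (intro mult_right_mono) (simp_all add: norm_power)
  qed
  hence 1: "3 * M \<le> A1 + A2" using I I2 eqM eqM2 by linarith
  have 2: "1 - x\<^sup>2 \<le> A1 + M" using I eqM by linarith
  have 3: "x * y \<le> A1 + M" using G.first_coeff_times_mean unfolding x_def y_def A1_def M_def .
  have 4: "y\<^sup>2 \<le> M"
    using sum_le_suminf[OF sums_summable[OF S], of "{0}"] sums_unique[OF S] by (simp add: y_def)
  have 5: "A1\<^sup>2 \<le> (\<integral>u. ((cmod (G u))\<^sup>2 - 1)\<^sup>2 \<partial>unit_circle)"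
    unfolding A1_def by (intro circle_mean_square_le continuous_intros G.cont)
  have 6: "A2\<^sup>2 \<le> (\<integral>u. ((cmod (G2 u))\<^sup>2 - 1)\<^sup>2 \<partial>unit_circle)"
    unfolding A2_def by (intro circle_mean_square_le continuous_intros G2.cont)
  have 7: "(x * y)\<^sup>2 \<le> (A1 + M)\<^sup>2" using nonneg 3 by (intro power_mono) auto
  have "(1 - x\<^sup>2) * y\<^sup>2 \<le> (A1 + M) * y\<^sup>2" using 2 by (intro mult_right_mono) auto
  also have "\<dots> \<le> (A1 + M) * M" using 4 nonneg by (intro mult_left_mono) auto
  finally have 8: "(1 - x\<^sup>2) * y\<^sup>2 \<le> (A1 + M) * M" .
  \<comment> \<open>Both summands are quadratic in the error \<open>A1 + M\<close>, because \<open>y\<^sup>2 \<le> M\<close>.\<close>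
  have "y\<^sup>2 = (x * y)\<^sup>2 + (1 - x\<^sup>2) * y\<^sup>2" by (simp add: algebra_simps power_mult_distrib)
  also have "\<dots> \<le> (A1 + M)\<^sup>2 + (A1 + M) * M"
    using 7 8 by linarith
  also have "\<dots> \<le> 2 * (A1 + M)\<^sup>2" using nonneg by (simp add: power2_eq_square algebra_simps)
  also have "\<dots> \<le> 2 * ((4 * A1 + A2) / 3)\<^sup>2"
    using nonneg 1 by (intro mult_left_mono power_mono) auto
  also have "\<dots> \<le> 4 * (A1\<^sup>2 + A2\<^sup>2)"
  proof -
    have "0 \<le> 2 * (A1 - 4 * A2)\<^sup>2 + 2 * A1\<^sup>2 + 2 * A2\<^sup>2" by simp
    thus ?thesis by (simp add: power2_eq_square field_simps)
  qed
  also have "\<dots> \<le> 4 * ((\<integral>u. ((cmod (G u))\<^sup>2 - 1)\<^sup>2 \<partial>unit_circle)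
    + (\<integral>u. ((cmod (G2 u))\<^sup>2 - 1)\<^sup>2 \<partial>unit_circle))"
    using 5 6 by (intro mult_left_mono add_mono) auto
  finally show ?thesis unfolding y_def .
qed

text \<open>
The radius vector \<open>w\<close> may point in any direction: its argument is absorbed into the coefficients.
\<close>

lemma entire_circle_series:
  assumes F: "F holomorphic_on UNIV"
  shows "circle_series (\<lambda>n. (deriv ^^ n) F z / fact n * w ^ n) (\<lambda>u. F (z + u * w))"
proof
  have contF: "continuous_on UNIV F" by (rule holomorphic_on_imp_continuous_on[OF F])
  show "continuous_on UNIV (\<lambda>u. F (z + u * w))"
    by (rule continuous_on_compose2[OF contF]) (auto intro!: continuous_intros)
  have sums: "(\<lambda>n. (deriv ^^ n) F z / fact n * v ^ n) sums F (z + v)" for v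
    using holomorphic_power_series[of F z "cmod v + 1" "z + v"] holomorphic_on_subset[OF F] 
    by (auto simp: dist_norm)
  show "summable (\<lambda>n. cmod ((deriv ^^ n) F z / fact n * w ^ n))"
    using powser_insidea[OF sums_summable[OF sums[of "of_real (cmod w + 1)"]], of w]
    by simp
  fix u :: complex
  show "(\<lambda>n. (deriv ^^ n) F z / fact n * w ^ n * u ^ n) sums F (z + u * w)"
    using sums[of "u * w"] by (simp add: power_mult_distrib mult_ac)
qed

lemma entire_mean_value:
  assumes "F holomorphic_on UNIV"
  shows "(\<integral>u. F (z + u * w) \<partial>unit_circle) = F z"
  using circle_series.mean_value[OF entire_circle_series[OF assms, of z w]] by simp

lemma deriv_bound_by_circle_means:
  assumes F: "F holomorphic_on UNIV"
  shows "(cmod (deriv F z))\<^sup>2 * (cmod w)\<^sup>2 \<le> 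
     4 * ((\<integral>u. ((cmod (F (z + u * w)))\<^sup>2 - 1)\<^sup>2 \<partial>unit_circle)
        + (\<integral>u. ((cmod (F (z + u * (2 * w))))\<^sup>2 - 1)\<^sup>2 \<partial>unit_circle))"
proof -
  have "circle_series (\<lambda>n. 2 ^ n * ((deriv ^^ n) F z / fact n * w ^ n)) (\<lambda>u. F (z + u * (2 * w)))"
    using entire_circle_series[OF F, of z "2 * w"] by (simp add: power_mult_distrib mult_ac)
  from first_coeff_bound[OF entire_circle_series[OF F] this]
  show ?thesis by (simp add: norm_mult power_mult_distrib)
qed

section \<open>Rotation averages and Gaussian moments\<close>

interpretation circle_lborel: pair_sigma_finite unit_circle "lborel :: complex measure" ..

lemma nn_integral_rotation_average:
  assumes [measurable]: "g \<in> borel_measurable borel"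
  shows "(\<integral>\<^sup>+ z. (\<integral>\<^sup>+ u. g (u * z) \<partial>unit_circle) \<partial>lborel) = (\<integral>\<^sup>+ z. g z \<partial>lborel)"
proof -
  have "(\<integral>\<^sup>+ z. (\<integral>\<^sup>+ u. g (u * z) \<partial>unit_circle) \<partial>lborel) = (\<integral>\<^sup>+ u. (\<integral>\<^sup>+ z. g (u * z) \<partial>lborel) \<partial>unit_circle)"
    by (rule circle_lborel.Fubini') measurable
  also have "\<dots> = (\<integral>\<^sup>+ u. (\<integral>\<^sup>+ z. g z \<partial>lborel) \<partial>unit_circle)"
    using AE_unit_circle by (intro nn_integral_cong_AE) (auto elim!: eventually_mono simp: nn_integral_lborel_rotate)
  finally show ?thesis by (simp add: unit_circle.emeasure_space_1[simplified])
qed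

lemma sets_gaussian_measure [measurable_cong, simp]: "sets gaussian_measure = sets borel"
  by (simp add: gaussian_measure_def)

lemma nn_integral_gaussian:
  assumes [measurable]: "g \<in> borel_measurable borel"
  shows "(\<integral>\<^sup>+ z. g z \<partial>gaussian_measure) = (\<integral>\<^sup>+ z. ennreal (exp (- (cmod z)\<^sup>2) / pi) * g z \<partial>lborel)"
  unfolding gaussian_measure_def by (rule nn_integral_density) auto

text \<open>
The Gaussian density is radial, so it passes through the average over rotations.
\<close>

lemma nn_integral_gaussian_rotation_average:
  assumes [measurable]: "g \<in> borel_measurable borel"
  shows "(\<integral>\<^sup>+ z. g z \<partial>gaussian_measure) = (\<integral>\<^sup>+ z. (\<integral>\<^sup>+ u. g (u * z) \<partial>unit_circle) \<partial>gaussian_measure)"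
proof -
  let ?e = "\<lambda>z. ennreal (exp (- (cmod z)\<^sup>2) / pi)"
  have "(\<integral>\<^sup>+ z. g z \<partial>gaussian_measure) = (\<integral>\<^sup>+ z. (\<integral>\<^sup>+ u. ?e (u * z) * g (u * z) \<partial>unit_circle) \<partial>lborel)"
    using nn_integral_rotation_average[of "\<lambda>z. ?e z * g z"] by (simp add: nn_integral_gaussian)
  also have "\<dots> = (\<integral>\<^sup>+ z. ?e z * (\<integral>\<^sup>+ u. g (u * z) \<partial>unit_circle) \<partial>lborel)"
  proof (rule nn_integral_cong)
    fix z :: complex
    have "(\<integral>\<^sup>+ u. ?e (u * z) * g (u * z) \<partial>unit_circle) = (\<integral>\<^sup>+ u. ?e z * g (u * z) \<partial>unit_circle)"
      using AE_unit_circle by (intro nn_integral_cong_AE) (auto elim!: eventually_mono simp: norm_mult)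
    thus "(\<integral>\<^sup>+ u. ?e (u * z) * g (u * z) \<partial>unit_circle) = ?e z * (\<integral>\<^sup>+ u. g (u * z) \<partial>unit_circle)"
      by (simp add: nn_integral_cmult)
  qed
  also have "\<dots> = (\<integral>\<^sup>+ z. (\<integral>\<^sup>+ u. g (u * z) \<partial>unit_circle) \<partial>gaussian_measure)"
    by (rule nn_integral_gaussian[symmetric]) measurable
  finally show ?thesis .
qed

lemma nn_integral_gaussian_radial:
  assumes [measurable]: "g \<in> borel_measurable borel" and nonneg: "\<And>s. s \<ge> 0 \<Longrightarrow> g s \<ge> (0::real)"
  shows "(\<integral>\<^sup>+ z. ennreal (g ((cmod z)\<^sup>2)) \<partial>gaussian_measure)
     = (\<integral>\<^sup>+ s. ennreal (g s * exp (- s)) * indicator {0..} s \<partial>lborel)"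
proof -
  have "(\<integral>\<^sup>+ z. ennreal (g ((cmod z)\<^sup>2)) \<partial>gaussian_measure)
    = (\<integral>\<^sup>+ z. ennreal (exp (- (cmod z)\<^sup>2) / pi) * ennreal (g ((cmod z)\<^sup>2)) \<partial>lborel)"
    by (rule nn_integral_gaussian) measurable
  also have "\<dots> = ennreal pi * (\<integral>\<^sup>+ s. ennreal (exp (- s) / pi) * ennreal (g s) * indicator {0..} s \<partial>lborel)"
    by (rule nn_integral_radial[of "\<lambda>s. ennreal (exp (- s) / pi) * ennreal (g s)"]) measurable
  also have "\<dots> = (\<integral>\<^sup>+ s. ennreal pi * (ennreal (exp (- s) / pi) * ennreal (g s) * indicator {0..} s) \<partial>lborel)"
    by (rule nn_integral_cmult[symmetric]) measurable
  also have "\<dots> = (\<integral>\<^sup>+ s. ennreal (g s * exp (- s)) * indicator {0..} s \<partial>lborel)"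
    by (intro nn_integral_cong) 
      (auto simp: indicator_def nonneg mult_ac simp flip: ennreal_mult')
  finally show ?thesis .
qed

lemma gaussian_moment_cmod:
  "(\<integral>\<^sup>+ z. ennreal (((cmod z)\<^sup>2) ^ n) \<partial>gaussian_measure) = ennreal (fact n)"
  using nn_intergal_power_times_exp_Ici[of n] 
  by (subst nn_integral_gaussian_radial) (auto simp: ennreal_of_nat_eq_real_of_nat)

text \<open>
By Jensen's inequality for \<open>x \<mapsto> 1/x\<close>, in the form of the tangent inequality \<open>1/x \<ge> 2/a - x/a\<^sup>2\<close>.
The choice \<open>a = n + 2\<close> is the mean of \<open>1 + \<bar>z\<bar>\<^sup>2\<close> with respect to the normalised weight
\<open>\<bar>z\<bar>\<^sup>2\<^sup>n d\<gamma>\<close>.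
\<close>

lemma gaussian_moment_damped:
  "ennreal (fact n / (n + 2)) \<le> (\<integral>\<^sup>+ z. ennreal (((cmod z)\<^sup>2) ^ n / (1 + (cmod z)\<^sup>2)) \<partial>gaussian_measure)"
proof -
  let ?a = "real (n + 2)"
  let ?I = "\<integral>\<^sup>+ z. ennreal (((cmod z)\<^sup>2) ^ n / (1 + (cmod z)\<^sup>2)) \<partial>gaussian_measure"
  have pt: "2 / ?a * s ^ n \<le> s ^ n / (1 + s) + (1 / ?a\<^sup>2 * s ^ n + 1 / ?a\<^sup>2 * s ^ Suc n)" if "s \<ge> 0" for s :: real
  proof -
    have tangent: "2 / a \<le> 1 / x + x / a\<^sup>2" if "a > 0" "x > 0" for a x :: real
    proof -
      have "1 / x + x / a\<^sup>2 - 2 / a = (x - a)\<^sup>2 / (x * a\<^sup>2)"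
        using that by (simp add: field_simps power2_eq_square)
      moreover have "\<dots> \<ge> 0" using that by simp
      ultimately show ?thesis by linarith
    qed
    have "2 / ?a \<le> 1 / (1 + s) + (1 + s) / ?a\<^sup>2"
      using that by (intro tangent) auto
    hence "2 / ?a * s ^ n \<le> (1 / (1 + s) + (1 + s) / ?a\<^sup>2) * s ^ n"
      using that by (intro mult_right_mono) auto
    thus ?thesis by (simp add: algebra_simps add_divide_distrib)
  qed
  have "(1 / ?a\<^sup>2 * fact n + 1 / ?a\<^sup>2 * fact (Suc n)) = fact n * ?a / ?a\<^sup>2"
    by (simp add: field_simps)
  also have "\<dots> = fact n / ?a" by (simp add: power2_eq_square)
  finally have eq: "(1 / ?a\<^sup>2 * fact n + 1 / ?a\<^sup>2 * fact (Suc n)) = fact n / ?a" .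
  have "ennreal (fact n / ?a) + ennreal (fact n / ?a) = ennreal (2 / ?a) * ennreal (fact n)"
    by (simp flip: ennreal_plus ennreal_mult')
  also have "\<dots> = (\<integral>\<^sup>+ z. ennreal (2 / ?a) * ennreal (((cmod z)\<^sup>2) ^ n) \<partial>gaussian_measure)"
    by (subst nn_integral_cmult) (auto simp: gaussian_moment_cmod)
  also have "\<dots> \<le> (\<integral>\<^sup>+ z. ennreal (((cmod z)\<^sup>2) ^ n / (1 + (cmod z)\<^sup>2)) + 
      (ennreal (1 / ?a\<^sup>2) * ennreal (((cmod z)\<^sup>2) ^ n) + ennreal (1 / ?a\<^sup>2) * ennreal (((cmod z)\<^sup>2) ^ Suc n)) \<partial>gaussian_measure)"
  proof (rule nn_integral_mono)
    fix z :: complex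
    show "ennreal (2 / ?a) * ennreal (((cmod z)\<^sup>2) ^ n) \<le> ennreal (((cmod z)\<^sup>2) ^ n / (1 + (cmod z)\<^sup>2)) + 
      (ennreal (1 / ?a\<^sup>2) * ennreal (((cmod z)\<^sup>2) ^ n) + ennreal (1 / ?a\<^sup>2) * ennreal (((cmod z)\<^sup>2) ^ Suc n))"
      using pt[of "(cmod z)\<^sup>2"] 
      by (subst ennreal_mult'[symmetric] ennreal_plus[symmetric], (simp; fail), (simp; fail)?)+ (rule ennreal_leI, simp)
  qed
  also have "\<dots> = ?I + (ennreal (1 / ?a\<^sup>2) * ennreal (fact n) + ennreal (1 / ?a\<^sup>2) * ennreal (fact (Suc n)))"
    by (subst nn_integral_add nn_integral_cmult, measurable)+ (simp only: gaussian_moment_cmod)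
  also have "ennreal (1 / ?a\<^sup>2) * ennreal (fact n) + ennreal (1 / ?a\<^sup>2) * ennreal (fact (Suc n)) = ennreal (fact n / ?a)"
  proof -
    have m: "ennreal (1 / ?a\<^sup>2) * ennreal x = ennreal (1 / ?a\<^sup>2 * x)" for x
      by (rule ennreal_mult'[symmetric]) simp
    show ?thesis unfolding m eq[symmetric] by (rule ennreal_plus[symmetric]) simp_all
  qed
  finally show ?thesis by (simp add: add.commute ennreal_add_left_cancel_le)
qed


section \<open>A Hardy inequality in the Fock space\<close>

text \<open>
Orthogonality of the monomials for any radial weight: Parseval's identity on each circle around the origin, followed by integration over the
circles.
\<close>

lemma nn_integral_gaussian_power_series:
  fixes wt :: "real \<Rightarrow> real"
  assumes F: "F holomorphic_on UNIV"
    and wt [measurable]: "wt \<in> borel_measurable borel" and wt_nonneg: "\<And>s. s \<ge> 0 \<Longrightarrow> wt s \<ge> 0"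
  shows "(\<integral>\<^sup>+ z. ennreal ((cmod (F z))\<^sup>2 * wt ((cmod z)\<^sup>2)) \<partial>gaussian_measure)
    = (\<Sum>n. ennreal ((cmod ((deriv ^^ n) F 0 / fact n))\<^sup>2) *
         (\<integral>\<^sup>+ z. ennreal (((cmod z)\<^sup>2) ^ n * wt ((cmod z)\<^sup>2)) \<partial>gaussian_measure))"
proof -
  let ?a = "\<lambda>n. (deriv ^^ n) F 0 / fact n"
  have contF: "continuous_on UNIV F" by (rule holomorphic_on_imp_continuous_on[OF F])
  have [measurable]: "F \<in> borel_measurable borel"
    by (rule borel_measurable_continuous_onI[OF contF])
  have inner: "(\<integral>\<^sup>+ u. ennreal ((cmod (F (u * z)))\<^sup>2 * wt ((cmod (u * z))\<^sup>2)) \<partial>unit_circle)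
      = (\<Sum>n. ennreal ((cmod (?a n))\<^sup>2) * ennreal (((cmod z)\<^sup>2) ^ n * wt ((cmod z)\<^sup>2)))" for z
  proof -
    interpret circle_series "\<lambda>n. ?a n * z ^ n" "\<lambda>u. F (u * z)"
      using entire_circle_series[OF F, of 0 z] by simp
    have "(\<integral>\<^sup>+ u. ennreal ((cmod (F (u * z)))\<^sup>2 * wt ((cmod (u * z))\<^sup>2)) \<partial>unit_circle)
       = (\<integral>\<^sup>+ u. ennreal (wt ((cmod z)\<^sup>2)) * ennreal ((cmod (F (u * z)))\<^sup>2) \<partial>unit_circle)"
      using AE_unit_circle
      by (intro nn_integral_cong_AE)
        (auto elim!: eventually_mono simp: norm_mult ennreal_mult'' wt_nonneg mult.commute[of "ennreal (wt _)"])
    also have "\<dots> = ennreal (wt ((cmod z)\<^sup>2)) * (\<integral>\<^sup>+ u. ennreal ((cmod (F (u * z)))\<^sup>2) \<partial>unit_circle)"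
      by (rule nn_integral_cmult) measurable
    also have "(\<integral>\<^sup>+ u. ennreal ((cmod (F (u * z)))\<^sup>2) \<partial>unit_circle) = ennreal (\<integral>u. (cmod (F (u * z)))\<^sup>2 \<partial>unit_circle)"
      by (rule nn_integral_eq_integral) auto
    also have "\<dots> = (\<Sum>n. ennreal ((cmod (?a n * z ^ n))\<^sup>2))"
      using parseval by (intro suminf_ennreal_eq[symmetric]) auto
    also have "ennreal (wt ((cmod z)\<^sup>2)) * \<dots> = (\<Sum>n. ennreal (wt ((cmod z)\<^sup>2)) * ennreal ((cmod (?a n * z ^ n))\<^sup>2))"
      by (rule ennreal_suminf_cmult[symmetric])
    also have "\<dots> = (\<Sum>n. ennreal ((cmod (?a n))\<^sup>2) * ennreal (((cmod z)\<^sup>2) ^ n * wt ((cmod z)\<^sup>2)))"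
    proof (rule suminf_cong)
      fix n
      have "(cmod (?a n * z ^ n))\<^sup>2 = (cmod (?a n))\<^sup>2 * ((cmod z)\<^sup>2) ^ n"
        unfolding norm_mult norm_power power_mult_distrib by (simp only: power_mult[symmetric] mult.commute)
      thus "ennreal (wt ((cmod z)\<^sup>2)) * ennreal ((cmod (?a n * z ^ n))\<^sup>2)
        = ennreal ((cmod (?a n))\<^sup>2) * ennreal (((cmod z)\<^sup>2) ^ n * wt ((cmod z)\<^sup>2))"
        using wt_nonneg[of "(cmod z)\<^sup>2"] by (simp only: ennreal_mult'' [symmetric] ennreal_mult'[symmetric] zero_le_power2 zero_le_power mult_nonneg_nonneg) (simp add: mult_ac)
    qed
    finally show ?thesis .
  qed
  have "(\<integral>\<^sup>+ z. ennreal ((cmod (F z))\<^sup>2 * wt ((cmod z)\<^sup>2)) \<partial>gaussian_measure)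
    = (\<integral>\<^sup>+ z. (\<Sum>n. ennreal ((cmod (?a n))\<^sup>2) * ennreal (((cmod z)\<^sup>2) ^ n * wt ((cmod z)\<^sup>2))) \<partial>gaussian_measure)"
    unfolding inner[symmetric] by (rule nn_integral_gaussian_rotation_average) measurable
  also have "\<dots> = (\<Sum>n. \<integral>\<^sup>+ z. ennreal ((cmod (?a n))\<^sup>2) * ennreal (((cmod z)\<^sup>2) ^ n * wt ((cmod z)\<^sup>2)) \<partial>gaussian_measure)"
    by (rule nn_integral_suminf) measurable
  also have "\<dots> = (\<Sum>n. ennreal ((cmod (?a n))\<^sup>2) * (\<integral>\<^sup>+ z. ennreal (((cmod z)\<^sup>2) ^ n * wt ((cmod z)\<^sup>2)) \<partial>gaussian_measure))"
    by (intro suminf_cong nn_integral_cmult) measurable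
  finally show ?thesis .
qed

text \<open>
The coefficients of the derivative are \<open>(n + 1) a\<^sub>n\<^sub>+\<^sub>1\<close>, so the two sides can be compared term by term:
\<open>(n + 1)\<^sup>2\<close> times the damped moment, which is at least \<open>n!/(n + 2)\<close>, is at least half of
\<open>(n + 1)!\<close>.
\<close>

lemma fock_hardy_inequality:
  assumes F: "F holomorphic_on UNIV" and F0: "F 0 = 0"
  shows "(\<integral>\<^sup>+ z. ennreal ((cmod (F z))\<^sup>2) \<partial>gaussian_measure)
     \<le> 2 * (\<integral>\<^sup>+ z. ennreal ((cmod (deriv F z))\<^sup>2 / (1 + (cmod z)\<^sup>2)) \<partial>gaussian_measure)"
proof -
  let ?a = "\<lambda>n. (deriv ^^ n) F 0 / fact n"
  let ?b = "\<lambda>n. (deriv ^^ n) (deriv F) 0 / fact n"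
  have F': "deriv F holomorphic_on UNIV" using F by (intro holomorphic_deriv) auto
  have ba: "?b n = of_nat (Suc n) * ?a (Suc n)" for n
  proof -
    have "of_nat (Suc n) \<noteq> (0::complex)" by (rule of_nat_neq_0)
    thus ?thesis by (simp add: funpow_Suc_right del: of_nat_Suc funpow.simps)
  qed
  have "(\<integral>\<^sup>+ z. ennreal ((cmod (F z))\<^sup>2) \<partial>gaussian_measure) = (\<Sum>n. ennreal ((cmod (?a n))\<^sup>2) * ennreal (fact n))"
    using nn_integral_gaussian_power_series[OF F, of "\<lambda>_. 1"] by (simp add: gaussian_moment_cmod)
  also have "\<dots> = (\<Sum>n. ennreal ((cmod (?a (Suc n)))\<^sup>2) * ennreal (fact (Suc n)))"
    using F0 by (subst suminf_offset[where i = 1]) auto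
  also have "\<dots> \<le> (\<Sum>n. 2 * (ennreal ((cmod (?b n))\<^sup>2) * (\<integral>\<^sup>+ z. ennreal (((cmod z)\<^sup>2) ^ n / (1 + (cmod z)\<^sup>2)) \<partial>gaussian_measure)))"
  proof (rule suminf_le)
    fix n
    have "(cmod (?a (Suc n)))\<^sup>2 * fact (Suc n) \<le> 2 * ((cmod (?b n))\<^sup>2 * (fact n / (n + 2)))"
    proof -
      have "fact (Suc n) \<le> 2 * (real (Suc n))\<^sup>2 * (fact n / (n + 2))"
      proof -
        have "1 \<le> 2 * real (Suc n) / real (n + 2)" by simp
        hence "fact (Suc n) * 1 \<le> fact (Suc n) * (2 * real (Suc n) / real (n + 2))"
          by (rule mult_left_mono) simp
        thus ?thesis by (simp add: fact_Suc power2_eq_square mult_ac del: of_nat_Suc of_nat_add)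
      qed
      hence "(cmod (?a (Suc n)))\<^sup>2 * fact (Suc n) \<le> (cmod (?a (Suc n)))\<^sup>2 * (2 * (real (Suc n))\<^sup>2 * (fact n / (n + 2)))"
        by (intro mult_left_mono) auto
      also have "\<dots> = 2 * ((cmod (?b n))\<^sup>2 * (fact n / (n + 2)))"
        unfolding ba norm_mult norm_of_nat power_mult_distrib by (simp only: mult_ac)
      finally show ?thesis by (simp only: of_nat_add of_nat_numeral)
    qed
    hence "ennreal ((cmod (?a (Suc n)))\<^sup>2) * ennreal (fact (Suc n)) \<le> 2 * (ennreal ((cmod (?b n))\<^sup>2) * ennreal (fact n / (n + 2)))"
      by (simp add: ennreal_mult'[symmetric] ennreal_leI add.commute del: fact_Suc power_Suc funpow.simps flip: ennreal_numeral)
    also have "\<dots> \<le> 2 * (ennreal ((cmod (?b n))\<^sup>2) * (\<integral>\<^sup>+ z. ennreal (((cmod z)\<^sup>2) ^ n / (1 + (cmod z)\<^sup>2)) \<partial>gaussian_measure))"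
      using gaussian_moment_damped[of n] by (intro mult_left_mono) (auto simp: add.commute)
    finally show "ennreal ((cmod (?a (Suc n)))\<^sup>2) * ennreal (fact (Suc n)) \<le> 2 * (ennreal ((cmod (?b n))\<^sup>2) * (\<integral>\<^sup>+ z. ennreal (((cmod z)\<^sup>2) ^ n / (1 + (cmod z)\<^sup>2)) \<partial>gaussian_measure))" .
  qed auto
  also have "\<dots> = 2 * (\<integral>\<^sup>+ z. ennreal ((cmod (deriv F z))\<^sup>2 / (1 + (cmod z)\<^sup>2)) \<partial>gaussian_measure)"
    using nn_integral_gaussian_power_series[OF F', of "\<lambda>s. 1 / (1 + s)"] 
    by (simp add: ennreal_suminf_cmult)
  finally show ?thesis .
qed

section \<open>A derivative bound from local averages\<close>

text \<open>
Averaging over circles does not change an integral over a disc with the same centre. This turns circle means into area means.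
\<close>

lemma nn_integral_ball_circle_average:
  fixes z :: complex and s :: real
  assumes [measurable]: "g \<in> borel_measurable borel" and s: "s > 0"
  shows "(\<integral>\<^sup>+ \<zeta>. indicator (cball 0 1) \<zeta> * (\<integral>\<^sup>+ u. g (z + u * (s *\<^sub>R \<zeta>)) \<partial>unit_circle) \<partial>lborel)
    = ennreal (1 / s\<^sup>2) * (\<integral>\<^sup>+ w. indicator (cball z s) w * g w \<partial>lborel)"
proof -
  \<comment> \<open>The cut-off is rotation invariant and can be moved inside the circle mean.\<close>
  define G where "G \<zeta> = indicator (cball 0 1) \<zeta> * g (z + s *\<^sub>R \<zeta>)" for \<zeta> :: complex
  have [measurable]: "G \<in> borel_measurable borel"
    unfolding G_def by (intro borel_measurable_times_ennreal borel_measurable_indicator sets_cball_borel) measurable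
  have "(\<integral>\<^sup>+ \<zeta>. indicator (cball 0 1) \<zeta> * (\<integral>\<^sup>+ u. g (z + u * (s *\<^sub>R \<zeta>)) \<partial>unit_circle) \<partial>lborel)
    = (\<integral>\<^sup>+ \<zeta>. (\<integral>\<^sup>+ u. G (u * \<zeta>) \<partial>unit_circle) \<partial>lborel)"
  proof (rule nn_integral_cong)
    fix \<zeta> :: complex
    have "(\<integral>\<^sup>+ u. G (u * \<zeta>) \<partial>unit_circle)
        = (\<integral>\<^sup>+ u. indicator (cball 0 1) \<zeta> * g (z + u * (s *\<^sub>R \<zeta>)) \<partial>unit_circle)"
      using AE_unit_circle
      by (intro nn_integral_cong_AE) (auto elim!: eventually_mono simp: G_def norm_mult indicator_def)
    thus "indicator (cball 0 1) \<zeta> * (\<integral>\<^sup>+ u. g (z + u * (s *\<^sub>R \<zeta>)) \<partial>unit_circle) = (\<integral>\<^sup>+ u. G (u * \<zeta>) \<partial>unit_circle)"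
      by (simp add: nn_integral_cmult)
  qed
  also have "\<dots> = (\<integral>\<^sup>+ \<zeta>. G \<zeta> \<partial>lborel)" by (rule nn_integral_rotation_average) measurable
  also have "\<dots> = ennreal (1 / s\<^sup>2) * (\<integral>\<^sup>+ w. indicator (cball z s) w * g w \<partial>lborel)"
    unfolding G_def by (rule nn_integral_unit_cball_affine) (use s in auto)
  finally show ?thesis .
qed

text \<open>
This is the factor that appears on the derivative side when the bound by circle means is integrated over all radius vectors in the unit
disc.
\<close>

lemma unit_disc_second_moment:
  "(\<integral>\<^sup>+ \<zeta>. indicator (cball 0 1) \<zeta> * ennreal ((cmod \<zeta>)\<^sup>2) \<partial>lborel) = ennreal (pi / 2)"
proof -
  have "(\<integral>\<^sup>+ \<zeta>. indicator (cball 0 1) \<zeta> * ennreal ((cmod \<zeta>)\<^sup>2) \<partial>lborel)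
    = (\<integral>\<^sup>+ \<zeta>. indicator {..1} ((cmod \<zeta>)\<^sup>2) * ennreal ((cmod \<zeta>)\<^sup>2) \<partial>lborel)"
    by (intro nn_integral_cong) (auto simp: indicator_def power_le_one_iff abs_square_le_1)
  also have "\<dots> = ennreal pi * (\<integral>\<^sup>+ s. indicator {..1} s * ennreal s * indicator {0..} s \<partial>lborel)"
    by (rule nn_integral_radial) measurable
  also have "(\<integral>\<^sup>+ s. indicator {..1} s * ennreal s * indicator {0..} s \<partial>lborel) 
     = (\<integral>\<^sup>+ s. ennreal s * indicator {0..1} s \<partial>lborel)"
    by (intro nn_integral_cong) (auto simp: indicator_def)
  also have "\<dots> = ennreal (1\<^sup>2 / 2 - 0\<^sup>2 / 2)"
    by (rule nn_integral_FTC_Icc) (auto intro!: derivative_eq_intros)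
  also have "ennreal pi * ennreal (1\<^sup>2 / 2 - 0\<^sup>2 / 2) = ennreal (pi / 2)"
    by (subst ennreal_mult'[symmetric]) simp_all
  finally show ?thesis .
qed

text \<open>
The bound by the means over the circles through \<open>z + \<rho>\<zeta>\<close> and \<open>z + 2\<rho>\<zeta>\<close> is integrated over
\<open>\<zeta>\<close> in the unit disc. The constant arises from \<open>4 (1 + 1/4) = 5\<close> and \<open>\<pi>/2 \<ge> 1\<close>.
\<close>

lemma deriv_bound_by_local_average:
  assumes F: "F holomorphic_on UNIV" and \<rho>: "\<rho> > 0"
  shows "ennreal ((cmod (deriv F z))\<^sup>2 * \<rho>\<^sup>2) \<le> ennreal (5 / \<rho>\<^sup>2) *
    (\<integral>\<^sup>+ w. indicator (cball z (2 * \<rho>)) w * ennreal (((cmod (F w))\<^sup>2 - 1)\<^sup>2) \<partial>lborel)"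
proof -
  define h where "h w = ((cmod (F w))\<^sup>2 - 1)\<^sup>2" for w
  have contF: "continuous_on UNIV F" by (rule holomorphic_on_imp_continuous_on[OF F])
  have conth: "continuous_on UNIV h" unfolding h_def by (intro continuous_intros contF)
  have [measurable]: "h \<in> borel_measurable borel" by (rule borel_measurable_continuous_onI[OF conth])
  have hn: "(\<integral>\<^sup>+ u. ennreal (h (z + u * w)) \<partial>unit_circle) = ennreal (\<integral>u. h (z + u * w) \<partial>unit_circle)" for w
  proof (rule nn_integral_eq_integral)
    show "integrable unit_circle (\<lambda>u. h (z + u * w))"
      by (intro integrable_unit_circle continuous_on_compose2[OF conth] continuous_intros) auto
  qed (simp add: h_def)
  let ?d = "(cmod (deriv F z))\<^sup>2 * \<rho>\<^sup>2"
  let ?A = "\<lambda>s \<zeta>. \<integral>\<^sup>+ u. ennreal (h (z + u * (s *\<^sub>R \<zeta>))) \<partial>unit_circle"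
  let ?B = "\<integral>\<^sup>+ w. indicator (cball z (2 * \<rho>)) w * ennreal (h w) \<partial>lborel"
  have pt: "ennreal ?d * ennreal ((cmod \<zeta>)\<^sup>2) \<le> 4 * (?A \<rho> \<zeta> + ?A (2 * \<rho>) \<zeta>)" for \<zeta>
  proof -
    have "?d * (cmod \<zeta>)\<^sup>2 = (cmod (deriv F z))\<^sup>2 * (cmod (\<rho> *\<^sub>R \<zeta>))\<^sup>2"
      by (simp add: power_mult_distrib)
    also have "\<dots> \<le> 4 * ((\<integral>u. h (z + u * (\<rho> *\<^sub>R \<zeta>)) \<partial>unit_circle) + (\<integral>u. h (z + u * ((2 * \<rho>) *\<^sub>R \<zeta>)) \<partial>unit_circle))"
      using deriv_bound_by_circle_means[OF F, of z "\<rho> *\<^sub>R \<zeta>"] 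
      unfolding h_def by (simp add: scaleR_conv_of_real mult.assoc)
    finally have "ennreal (?d * (cmod \<zeta>)\<^sup>2) 
       \<le> ennreal (4 * ((\<integral>u. h (z + u * (\<rho> *\<^sub>R \<zeta>)) \<partial>unit_circle) + (\<integral>u. h (z + u * ((2 * \<rho>) *\<^sub>R \<zeta>)) \<partial>unit_circle)))"
      by (rule ennreal_leI)
    also have "\<dots> = 4 * (?A \<rho> \<zeta> + ?A (2 * \<rho>) \<zeta>)"
      unfolding hn by (subst ennreal_mult', simp, subst ennreal_plus) (auto simp: h_def)
    finally show ?thesis by (simp add: ennreal_mult')
  qed
  have "ennreal ?d * ennreal (pi / 2) 
     = (\<integral>\<^sup>+ \<zeta>. indicator (cball 0 1) \<zeta> * (ennreal ?d * ennreal ((cmod \<zeta>)\<^sup>2)) \<partial>lborel)"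
    unfolding unit_disc_second_moment[symmetric]
    by (subst nn_integral_cmult[symmetric]) (auto simp: mult_ac)
  also have "\<dots> \<le> (\<integral>\<^sup>+ \<zeta>. indicator (cball 0 1) \<zeta> * (4 * (?A \<rho> \<zeta> + ?A (2 * \<rho>) \<zeta>)) \<partial>lborel)"
    by (intro nn_integral_mono mult_left_mono pt) auto
  also have "\<dots> = (\<integral>\<^sup>+ \<zeta>. 4 * (indicator (cball 0 1) \<zeta> * ?A \<rho> \<zeta> + indicator (cball 0 1) \<zeta> * ?A (2 * \<rho>) \<zeta>) \<partial>lborel)"
    by (intro nn_integral_cong) (simp add: algebra_simps)
  also have "\<dots> = 4 * (ennreal (1 / \<rho>\<^sup>2) * (\<integral>\<^sup>+ w. indicator (cball z \<rho>) w * ennreal (h w) \<partial>lborel)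
      + ennreal (1 / (2 * \<rho>)\<^sup>2) * ?B)"
  proof -
    define f where "f s \<zeta> = indicator (cball 0 1) \<zeta> * ?A s \<zeta>" for s \<zeta>
    have [measurable]: "f s \<in> borel_measurable lborel" for s
      unfolding f_def by (intro borel_measurable_times_ennreal borel_measurable_indicator) measurable
    have avg: "(\<integral>\<^sup>+ \<zeta>. f s \<zeta> \<partial>lborel)
        = ennreal (1 / s\<^sup>2) * (\<integral>\<^sup>+ w. indicator (cball z s) w * ennreal (h w) \<partial>lborel)" if "s > 0" for s
      unfolding f_def by (rule nn_integral_ball_circle_average[OF _ that]) measurable
    have "(\<integral>\<^sup>+ \<zeta>. 4 * (f \<rho> \<zeta> + f (2 * \<rho>) \<zeta>) \<partial>lborel) = 4 * (\<integral>\<^sup>+ \<zeta>. f \<rho> \<zeta> + f (2 * \<rho>) \<zeta> \<partial>lborel)"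
      by (rule nn_integral_cmult) measurable
    also have "(\<integral>\<^sup>+ \<zeta>. f \<rho> \<zeta> + f (2 * \<rho>) \<zeta> \<partial>lborel) = (\<integral>\<^sup>+ \<zeta>. f \<rho> \<zeta> \<partial>lborel) + (\<integral>\<^sup>+ \<zeta>. f (2 * \<rho>) \<zeta> \<partial>lborel)"
      by (rule nn_integral_add) measurable
    finally show ?thesis
      using \<rho> by (simp only: f_def[symmetric] avg mult_pos_pos zero_less_numeral)
  qed
  also have "\<dots> \<le> 4 * (ennreal (1 / \<rho>\<^sup>2) * ?B + ennreal (1 / (2 * \<rho>)\<^sup>2) * ?B)"
    using \<rho> by (intro mult_left_mono add_mono nn_integral_mono mult_right_mono) (auto simp: indicator_def)
  also have "\<dots> = ennreal (5 / \<rho>\<^sup>2) * ?B"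
  proof -
    have "ennreal (5 / \<rho>\<^sup>2) = 4 * (ennreal (1 / \<rho>\<^sup>2) + ennreal (1 / (2 * \<rho>)\<^sup>2))"
      using \<rho> by (simp flip: ennreal_plus ennreal_numeral ennreal_mult' add: field_simps)
    thus ?thesis by (simp add: algebra_simps)
  qed
  finally have "ennreal ?d * ennreal (pi / 2) \<le> ennreal (5 / \<rho>\<^sup>2) * ?B" .
  moreover have "ennreal ?d * ennreal 1 \<le> ennreal ?d * ennreal (pi / 2)"
    using pi_gt3 by (intro mult_left_mono ennreal_leI) auto
  ultimately show ?thesis unfolding h_def by simp
qed

text \<open>
Moving \<open>z\<close> by a multiple of \<open>1/(1 + \<bar>z\<bar>)\<close> changes \<open>\<bar>z\<bar>\<^sup>2\<close> by a bounded
amount only. The third estimate lets the two points exchange their roles, as the exchange of integrals requires.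
\<close>

lemma gaussian_weight_slowly_varying:
  fixes z w :: complex
  assumes "dist z w \<le> 2 / sqrt (1 + (cmod z)\<^sup>2)"
  shows "exp (- (cmod z)\<^sup>2) \<le> exp 8 * exp (- (cmod w)\<^sup>2)"
    and "1 + (cmod z)\<^sup>2 \<le> 9 * (1 + (cmod w)\<^sup>2)"
    and "dist w z \<le> 6 / sqrt (1 + (cmod w)\<^sup>2)"
proof -
  let ?r = "1 / sqrt (1 + (cmod z)\<^sup>2)"
  have r: "0 < ?r" "?r \<le> 1" "?r * cmod z \<le> 1"
    by (auto simp: real_le_rsqrt divide_simps add_pos_nonneg)
  have d: "\<bar>cmod z - cmod w\<bar> \<le> 2 * ?r" using assms norm_triangle_ineq3[of z w] by (simp add: dist_norm)
  have "cmod w \<le> cmod z + 2 * ?r" using d by linarith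
  hence "(cmod w)\<^sup>2 \<le> (cmod z + 2 * ?r)\<^sup>2" by (intro power_mono) auto
  also have "\<dots> = (cmod z)\<^sup>2 + 4 * (?r * cmod z) + 4 * ?r\<^sup>2" by (simp add: power2_sum power_mult_distrib field_simps)
  also have "\<dots> \<le> (cmod z)\<^sup>2 + 4 * 1 + 4 * 1\<^sup>2" using r by (intro add_mono mult_left_mono power_mono) auto
  finally have w: "(cmod w)\<^sup>2 \<le> (cmod z)\<^sup>2 + 8" by simp
  thus "exp (- (cmod z)\<^sup>2) \<le> exp 8 * exp (- (cmod w)\<^sup>2)" by (simp flip: exp_add)
  have "cmod z \<le> cmod w + 2" using d r by linarith
  hence "(cmod z)\<^sup>2 \<le> (cmod w + 2)\<^sup>2" by (intro power_mono) auto
  also have "\<dots> \<le> 2 * (cmod w)\<^sup>2 + 8" 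
    using zero_le_power2[of "cmod w - 2"] by (simp add: power2_eq_square algebra_simps)
  also have "\<dots> \<le> 9 * (cmod w)\<^sup>2 + 8" by simp
  finally show "1 + (cmod z)\<^sup>2 \<le> 9 * (1 + (cmod w)\<^sup>2)" by simp
  note w
  also have "(cmod z)\<^sup>2 + 8 \<le> 9 * (cmod z)\<^sup>2 + 8" by simp
  finally have "sqrt (1 + (cmod w)\<^sup>2) \<le> sqrt (9 * (1 + (cmod z)\<^sup>2))"
    by (intro real_sqrt_le_mono) simp
  also have "\<dots> = 3 * sqrt (1 + (cmod z)\<^sup>2)" using real_sqrt_mult[of 9 "1 + (cmod z)\<^sup>2"] by simp
  finally have "sqrt (1 + (cmod w)\<^sup>2) \<le> 3 * sqrt (1 + (cmod z)\<^sup>2)" .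
  hence "2 / sqrt (1 + (cmod z)\<^sup>2) \<le> 6 / sqrt (1 + (cmod w)\<^sup>2)" 
    by (simp add: divide_simps add_pos_nonneg)
  thus "dist w z \<le> 6 / sqrt (1 + (cmod w)\<^sup>2)" using assms by (simp add: dist_commute)
qed

text \<open>
After the exchange of integrals, a point \<open>w\<close> is charged only by those \<open>z\<close> whose disc contains it. These lie in the
disc of radius \<open>6\<rho>(w)\<close>, where the weight is comparable to that at \<open>w\<close>, and the area
\<open>36\<pi>\<rho>(w)\<^sup>2\<close> of this disc cancels the factor \<open>\<rho>(w)\<^sup>-\<^sup>2\<close>. The factors 5 of the local
bound, \<open>9 exp 8\<close> of the comparison of weights and \<open>36\<pi>\<close> of the area make up the constant.
\<close>

lemma weighted_deriv_bound:
  assumes F: "F holomorphic_on UNIV"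
  shows "(\<integral>\<^sup>+ z. ennreal ((cmod (deriv F z))\<^sup>2 / (1 + (cmod z)\<^sup>2)) \<partial>gaussian_measure)
    \<le> ennreal (1620 * pi * exp 8) * (\<integral>\<^sup>+ w. ennreal (((cmod (F w))\<^sup>2 - 1)\<^sup>2) \<partial>gaussian_measure)"
proof -
  define h where "h w = ennreal (((cmod (F w))\<^sup>2 - 1)\<^sup>2)" for w
  define e where "e z = exp (- (cmod z)\<^sup>2) / pi" for z :: complex
  define q where "q z = 1 + (cmod z)\<^sup>2" for z :: complex
  have contF: "continuous_on UNIV F" by (rule holomorphic_on_imp_continuous_on[OF F])
  have contF': "continuous_on UNIV (deriv F)"
    by (intro holomorphic_on_imp_continuous_on holomorphic_deriv F) auto
  have [measurable]: "F \<in> borel_measurable borel" "deriv F \<in> borel_measurable borel"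
    by (rule borel_measurable_continuous_onI[OF contF] borel_measurable_continuous_onI[OF contF'])+
  have [measurable]: "h \<in> borel_measurable borel" "e \<in> borel_measurable borel" "q \<in> borel_measurable borel"
    unfolding h_def e_def q_def by measurable
  have q: "q z > 0" for z by (simp add: q_def add_pos_nonneg)
  have e: "e z > 0" for z by (simp add: e_def)
  \<comment> \<open>The disc around \<open>z\<close>, written as a relation between \<open>z\<close> and \<open>w\<close> so that it is jointly measurable.\<close>
  let ?I = "\<lambda>z w. indicator {p. dist (fst p) (snd p) \<le> 2 / sqrt (q (fst p))} (z, w) :: ennreal"
  have [measurable]: "(\<lambda>p. indicator {p. dist (fst p) (snd p) \<le> 2 / sqrt (q (fst p))} p :: ennreal) \<in> borel_measurable (borel \<Otimes>\<^sub>M borel)"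
    by measurable
  have "(\<integral>\<^sup>+ z. ennreal ((cmod (deriv F z))\<^sup>2 / q z) \<partial>gaussian_measure)
      = (\<integral>\<^sup>+ z. ennreal (e z) * ennreal ((cmod (deriv F z))\<^sup>2 / q z) \<partial>lborel)"
    unfolding e_def by (rule nn_integral_gaussian) measurable
  also have "\<dots> \<le> (\<integral>\<^sup>+ z. ennreal (e z) * (ennreal (5 * q z) * (\<integral>\<^sup>+ w. ?I z w * h w \<partial>lborel)) \<partial>lborel)"
  proof (intro nn_integral_mono mult_left_mono)
    fix z :: complex
    have "(\<integral>\<^sup>+ w. indicator (cball z (2 * (1 / sqrt (q z)))) w * h w \<partial>lborel) = (\<integral>\<^sup>+ w. ?I z w * h w \<partial>lborel)"
      by (intro nn_integral_cong) (auto simp: indicator_def)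
    thus "ennreal ((cmod (deriv F z))\<^sup>2 / q z) \<le> ennreal (5 * q z) * (\<integral>\<^sup>+ w. ?I z w * h w \<partial>lborel)"
      using deriv_bound_by_local_average[OF F, of "1 / sqrt (q z)" z] q[of z]
      unfolding h_def[symmetric] by (simp add: power_divide)
  qed simp
  also have "\<dots> = (\<integral>\<^sup>+ z. (\<integral>\<^sup>+ w. ennreal (5 * (e z * q z)) * ?I z w * h w \<partial>lborel) \<partial>lborel)"
  proof (rule nn_integral_cong)
    fix z :: complex
    have "ennreal (e z) * (ennreal (5 * q z) * X) = ennreal (5 * (e z * q z)) * X" for X
      using e[of z] q[of z] by (simp add: ennreal_mult' mult_ac)
    thus "ennreal (e z) * (ennreal (5 * q z) * (\<integral>\<^sup>+ w. ?I z w * h w \<partial>lborel))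
       = (\<integral>\<^sup>+ w. ennreal (5 * (e z * q z)) * ?I z w * h w \<partial>lborel)"
      by (simp add: mult.assoc nn_integral_cmult)
  qed
  also have "\<dots> = (\<integral>\<^sup>+ w. (\<integral>\<^sup>+ z. ennreal (5 * (e z * q z)) * ?I z w * h w \<partial>lborel) \<partial>lborel)"
    by (rule lborel_pair.Fubini'[symmetric]) measurable
  also have "\<dots> \<le> (\<integral>\<^sup>+ w. ennreal (1620 * pi * exp 8) * (ennreal (e w) * h w) \<partial>lborel)"
  proof (rule nn_integral_mono)
    fix w :: complex
    have "(\<integral>\<^sup>+ z. ennreal (5 * (e z * q z)) * ?I z w * h w \<partial>lborel)
      \<le> (\<integral>\<^sup>+ z. (ennreal (45 * exp 8 * e w * q w) * h w) * indicator (cball w (6 / sqrt (q w))) z \<partial>lborel)"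
    proof (rule nn_integral_mono)
      fix z :: complex
      show "ennreal (5 * (e z * q z)) * ?I z w * h w \<le> (ennreal (45 * exp 8 * e w * q w) * h w) * indicator (cball w (6 / sqrt (q w))) z"
      proof (cases "dist z w \<le> 2 / sqrt (q z)")
        case True
        note close = gaussian_weight_slowly_varying[OF True[unfolded q_def]]
        have "e z * q z \<le> (exp 8 * e w) * (9 * q w)"
          using close(1,2) q[of z] q[of w] e[of w]
          by (intro mult_mono) (auto simp: e_def q_def divide_right_mono)
        hence "ennreal (5 * (e z * q z)) \<le> ennreal (45 * exp 8 * e w * q w)"
          by (intro ennreal_leI) (simp add: mult_ac)
        moreover have "z \<in> cball w (6 / sqrt (q w))" using close(3) by (simp add: q_def)
        ultimately show ?thesis using True by (simp add: mult_right_mono)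
      qed simp
    qed
    also have "\<dots> = (ennreal (45 * exp 8 * e w * q w) * h w) * emeasure lborel (cball w (6 / sqrt (q w)))"
      by (rule nn_integral_cmult_indicator) simp
    also have "emeasure lborel (cball w (6 / sqrt (q w))) = ennreal (36 * pi / q w)"
      using q[of w] by (simp add: emeasure_cball unit_ball_vol_2 power_divide)
    also have "(ennreal (45 * exp 8 * e w * q w) * h w) * ennreal (36 * pi / q w)
       = (ennreal (45 * exp 8 * e w * q w) * ennreal (36 * pi / q w)) * h w"
      by (simp only: mult_ac)
    also have "ennreal (45 * exp 8 * e w * q w) * ennreal (36 * pi / q w)
       = ennreal (45 * exp 8 * e w * q w * (36 * pi / q w))"
      using q[of w] by (intro ennreal_mult''[symmetric]) simp
    also have "45 * exp 8 * e w * q w * (36 * pi / q w) = (1620 * pi * exp 8) * e w"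
      using q[of w] by simp
    also have "ennreal \<dots> * h w = ennreal (1620 * pi * exp 8) * (ennreal (e w) * h w)"
      by (simp add: ennreal_mult' mult.assoc)
    finally show "(\<integral>\<^sup>+ z. ennreal (5 * (e z * q z)) * ?I z w * h w \<partial>lborel)
      \<le> ennreal (1620 * pi * exp 8) * (ennreal (e w) * h w)" .
  qed
  also have "\<dots> = ennreal (1620 * pi * exp 8) * (\<integral>\<^sup>+ w. h w \<partial>gaussian_measure)"
    unfolding e_def by (subst nn_integral_cmult) (auto simp: nn_integral_gaussian)
  finally show ?thesis unfolding h_def q_def .
qed

section \<open>Distance from the squared function to the unit circle\<close>

text \<open>
The identity already holds for the mean over each circle around the origin: pointwise
\<open>\<bar>F\<^sup>2 - \<lambda>\<bar>\<^sup>2\<close> is \<open>(\<bar>F\<bar>\<^sup>2 - 1)\<^sup>2 + 2 \<bar>F\<bar>\<^sup>2\<close>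
minus twice the real part of \<open>F\<^sup>2\<close> times the conjugate of \<open>\<lambda>\<close>; the mean of the last term is
\<open>2 \<bar>F 0\<bar>\<^sup>2\<close>, and the mean of \<open>\<bar>F\<bar>\<^sup>2\<close> exceeds
\<open>\<bar>F 0\<bar>\<^sup>2\<close> by that of \<open>\<bar>F - F 0\<bar>\<^sup>2\<close>.
\<close>

lemma fock_distance_identity:
  assumes F: "F holomorphic_on UNIV" and l: "cmod l = 1" "Re (cnj l * (F 0)\<^sup>2) = (cmod (F 0))\<^sup>2"
  shows "fock_norm_sq (\<lambda>z. (F z)\<^sup>2 - l) = fock_norm_sq (\<lambda>z. complex_of_real ((cmod (F z))\<^sup>2 - 1))
     + 2 * fock_norm_sq (\<lambda>z. F z - F 0)"
proof -
  have contF: "continuous_on UNIV F" by (rule holomorphic_on_imp_continuous_on[OF F])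
  have [measurable]: "F \<in> borel_measurable borel"
    by (rule borel_measurable_continuous_onI[OF contF])
  let ?h = "\<lambda>z. (cmod (complex_of_real ((cmod (F z))\<^sup>2 - 1)))\<^sup>2"
  have circle: "(\<integral>\<^sup>+ u. ennreal ((cmod ((F (u * z))\<^sup>2 - l))\<^sup>2) \<partial>unit_circle)
    = (\<integral>\<^sup>+ u. ennreal (?h (u * z)) + 2 * ennreal ((cmod (F (u * z) - F 0))\<^sup>2) \<partial>unit_circle)" for z
  proof -
    interpret circle_series "\<lambda>n. (deriv ^^ n) F 0 / fact n * z ^ n" "\<lambda>u. F (u * z)"
      using entire_circle_series[OF F, of 0 z] by simp
    note ci = integrable_unit_circle continuous_intros cont
    have eq: "(cmod ((F v)\<^sup>2 - l))\<^sup>2 = ?h v + (2 * (cmod (F v))\<^sup>2 - 2 * Re (cnj l * (F v)\<^sup>2))" for v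
    proof -
      have "(cmod ((F v)\<^sup>2 - l))\<^sup>2 = (cmod ((F v)\<^sup>2))\<^sup>2 - 2 * Re (cnj l * (F v)\<^sup>2) + (cmod l)\<^sup>2"
        unfolding cmod_power2[of "_ - _"] cmod_power2[of "_\<^sup>2"] cmod_power2[of l] by (simp add: power2_eq_square algebra_simps)
      moreover have "?h v = ((cmod (F v))\<^sup>2 - 1)\<^sup>2" by (simp only: norm_of_real power2_abs)
      moreover have "(cmod ((F v)\<^sup>2))\<^sup>2 = ((cmod (F v))\<^sup>2)\<^sup>2" by (simp only: norm_power)
      ultimately show ?thesis
        using l(1) by (simp only: power2_diff)
    qed
    define H R where "H u = ?h (u * z)" and "R u = Re (cnj l * (F (u * z))\<^sup>2)" for u
    have int: "integrable unit_circle H" "integrable unit_circle R"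
      "integrable unit_circle (\<lambda>u. (cmod (F (u * z) - F 0))\<^sup>2)"
      "integrable unit_circle (\<lambda>u. (cmod ((F (u * z))\<^sup>2 - l))\<^sup>2)"
      unfolding H_def R_def by (intro ci)+
    have "(\<integral>u. R u \<partial>unit_circle) = Re (\<integral>u. cnj l * (F (u * z))\<^sup>2 \<partial>unit_circle)"
      unfolding R_def by (rule integral_Re) (intro ci)
    also have "\<dots> = (cmod (F 0))\<^sup>2"
      using entire_mean_value[of "\<lambda>z. (F z)\<^sup>2" 0 z] F l(2) by (simp add: holomorphic_on_power)
    finally have R: "(\<integral>u. R u \<partial>unit_circle) = (cmod (F 0))\<^sup>2" .
    have "(\<integral>u. (cmod ((F (u * z))\<^sup>2 - l))\<^sup>2 \<partial>unit_circle)
      = (\<integral>u. H u + (2 * (cmod (F (u * z)))\<^sup>2 - 2 * R u) \<partial>unit_circle)"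
      unfolding H_def R_def eq ..
    also have "\<dots> = (\<integral>u. H u \<partial>unit_circle) + (2 * (\<integral>u. (cmod (F (u * z)))\<^sup>2 \<partial>unit_circle) - 2 * (cmod (F 0))\<^sup>2)"
      using int by (simp add: R)
    also have "\<dots> = (\<integral>u. H u \<partial>unit_circle) + 2 * (\<integral>u. (cmod (F (u * z) - F 0))\<^sup>2 \<partial>unit_circle)"
      using mean_square_deviation by simp
    also have "\<dots> = (\<integral>u. H u + 2 * (cmod (F (u * z) - F 0))\<^sup>2 \<partial>unit_circle)"
      using int by simp
    finally have "ennreal (\<integral>u. (cmod ((F (u * z))\<^sup>2 - l))\<^sup>2 \<partial>unit_circle)
       = ennreal (\<integral>u. H u + 2 * (cmod (F (u * z) - F 0))\<^sup>2 \<partial>unit_circle)" by (simp only:)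
    also have "ennreal (\<integral>u. (cmod ((F (u * z))\<^sup>2 - l))\<^sup>2 \<partial>unit_circle) = (\<integral>\<^sup>+ u. ennreal ((cmod ((F (u * z))\<^sup>2 - l))\<^sup>2) \<partial>unit_circle)"
      by (rule nn_integral_eq_integral[symmetric]) (use int in auto)
    also have "ennreal (\<integral>u. H u + 2 * (cmod (F (u * z) - F 0))\<^sup>2 \<partial>unit_circle)
       = (\<integral>\<^sup>+ u. ennreal (H u + 2 * (cmod (F (u * z) - F 0))\<^sup>2) \<partial>unit_circle)"
      by (intro nn_integral_eq_integral[symmetric] Bochner_Integration.integrable_add integrable_mult_right int)
        (simp add: H_def)
    also have "\<dots> = (\<integral>\<^sup>+ u. ennreal (?h (u * z)) + 2 * ennreal ((cmod (F (u * z) - F 0))\<^sup>2) \<partial>unit_circle)"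
      by (intro nn_integral_cong) (simp add: H_def ennreal_mult' ennreal_plus)
    finally show ?thesis .
  qed
  have "fock_norm_sq (\<lambda>z. (F z)\<^sup>2 - l) = (\<integral>\<^sup>+ z. ennreal (?h z) + 2 * ennreal ((cmod (F z - F 0))\<^sup>2) \<partial>gaussian_measure)"
    unfolding fock_norm_sq_def
    by (subst (1 2) nn_integral_gaussian_rotation_average) (measurable, simp only: circle)
  also have "\<dots> = fock_norm_sq (\<lambda>z. complex_of_real ((cmod (F z))\<^sup>2 - 1)) + 2 * fock_norm_sq (\<lambda>z. F z - F 0)"
    unfolding fock_norm_sq_def by (subst nn_integral_add) (auto simp: nn_integral_cmult)
  finally show ?thesis .
qed

lemma fock_norm_le_if_fock_norm_sq_le:
  assumes le: "fock_norm_sq H \<le> ennreal (C\<^sup>2) * fock_norm_sq K" and C: "C > 0"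
  shows "fock_norm H \<le> ennreal C * fock_norm K"
proof (cases "fock_norm_sq K = \<infinity>")
  case True
  thus ?thesis using C by (simp add: fock_norm_def ennreal_mult_top)
next
  case False
  then obtain k where k: "fock_norm_sq K = ennreal k" "k \<ge> 0" by (cases "fock_norm_sq K") auto
  have le': "fock_norm_sq H \<le> ennreal (C\<^sup>2 * k)" using le k by (simp add: ennreal_mult')
  then obtain x where x: "fock_norm_sq H = ennreal x" "x \<ge> 0" by (cases "fock_norm_sq H") (auto simp: top_unique)
  have "x \<le> C\<^sup>2 * k" using le' x k by simp
  hence "sqrt x \<le> C * sqrt k" using C real_sqrt_le_mono[of x "C\<^sup>2 * k"] by (simp add: real_sqrt_mult)
  thus ?thesis using x k C by (simp add: fock_norm_def ennreal_leI flip: ennreal_mult')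
qed

theorem corollary1p2:
  shows "\<exists>C::real. C > 0 \<and>
    (\<forall>F :: complex \<Rightarrow> complex. F holomorphic_on UNIV \<longrightarrow> (\<lambda>z. (F z)\<^sup>2) \<in> fock_space \<longrightarrow>
      (INF l\<in>{l::complex. cmod l = 1}. fock_norm (\<lambda>z. (F z)\<^sup>2 - l))
        \<le> ennreal C * fock_norm (\<lambda>z. complex_of_real ((cmod (F z))\<^sup>2 - 1)))"
proof -
  let ?K = "1620 * pi * exp 8 :: real"
  define C where "C = sqrt (1 + 4 * ?K)"
  have C: "C > 0" "C\<^sup>2 = 1 + 4 * ?K" by (simp_all add: C_def add_pos_pos)
  show ?thesis
  proof (intro exI[of _ C] conjI allI impI C(1))
    fix F :: "complex \<Rightarrow> complex"
    assume F: "F holomorphic_on UNIV"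
    let ?D = "fock_norm_sq (\<lambda>z. complex_of_real ((cmod (F z))\<^sup>2 - 1))"
    obtain l where l: "cmod l = 1" "Re (cnj l * (F 0)\<^sup>2) = (cmod (F 0))\<^sup>2"
    proof (cases "F 0 = 0")
      case True
      thus ?thesis using that[of 1] by simp
    next
      case False
      have "cnj (sgn w) * w = complex_of_real (cmod w)" if "w \<noteq> 0" for w
        using that complex_norm_square[of w] 
        by (simp add: sgn_eq power2_eq_square divide_simps mult.commute)
      hence "cnj (sgn ((F 0)\<^sup>2)) * (F 0)\<^sup>2 = complex_of_real ((cmod (F 0))\<^sup>2)"
        using False by (simp add: norm_power)
      thus ?thesis using that[of "sgn ((F 0)\<^sup>2)"] False by (simp add: norm_sgn)
    qed
    have f: "(\<lambda>z. F z - F 0) holomorphic_on UNIV" by (intro holomorphic_intros F)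
    have df: "deriv (\<lambda>z. F z - F 0) = deriv F"
      using F by (auto simp: fun_eq_iff deriv_diff holomorphic_on_imp_differentiable_at)
    have "fock_norm_sq (\<lambda>z. F z - F 0) \<le> 2 * (ennreal ?K * ?D)"
      using order_trans[OF fock_hardy_inequality[OF f, simplified df] mult_left_mono[OF weighted_deriv_bound[OF F]]]
      unfolding fock_norm_sq_def norm_of_real power2_abs by simp
    hence "fock_norm_sq (\<lambda>z. (F z)\<^sup>2 - l) \<le> ?D + 2 * (2 * (ennreal ?K * ?D))"
      unfolding fock_distance_identity[OF F l] by (intro add_left_mono mult_left_mono) auto
    also have "\<dots> = ennreal (C\<^sup>2) * ?D"
    proof -
      have "ennreal (1 + 4 * k) * x = x + 2 * (2 * (ennreal k * x))" if "k \<ge> 0" for k x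
        using that by (simp add: ennreal_plus ennreal_mult' distrib_right mult.assoc[symmetric])
      from this[of ?K] show ?thesis unfolding C(2) by simp
    qed
    finally have "fock_norm (\<lambda>z. (F z)\<^sup>2 - l) \<le> ennreal C * fock_norm (\<lambda>z. complex_of_real ((cmod (F z))\<^sup>2 - 1))"
      by (rule fock_norm_le_if_fock_norm_sq_le[OF _ C(1)])
    thus "(INF l\<in>{l. cmod l = 1}. fock_norm (\<lambda>z. (F z)\<^sup>2 - l)) \<le> ennreal C * fock_norm (\<lambda>z. complex_of_real ((cmod (F z))\<^sup>2 - 1))"
      using l(1) by (intro INF_lower2[of l]) auto
  qed
qed

end
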